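(* Let $n$ be a positive integer and let $D_1\subseteq[n-1]$ and $D_2\subseteq[n-1]$. Then (1) $$\sum_{\{\pi\in S_n\,:\,\mathrm{Des}_S(\pi^{-1})\subseteq D_1,\ \mathrm{Del}_S(\pi^{-1})\subseteq D_2\}} q^{\mathrm{rmaj}_{S_n}(\pi)}=\sum_{\{\pi\in S_n\,:\,\mathrm{Des}_S(\pi^{-1})\subseteq D_1,\ \mathrm{Del}_S(\pi^{-1})\subseteq D_2\}} q^{\ell_S(\pi)},$$ and (2) $$\sum_{\{\sigma\in A_{n+1}\,:\,\mathrm{Des}_A(\sigma^{-1})\subseteq D_1,\ \mathrm{Del}_A(\sigma^{-1})\subseteq D_2\}} q^{\mathrm{rmaj}_{A_{n+1}}(\sigma)}=\sum_{\{\sigma\in A_{n+1}\,:\,\mathrm{Des}_A(\sigma^{-1})\subseteq D_1,\ \mathrm{Del}_A(\sigma^{-1})\subseteq D_2\}} q^{\ell_A(\sigma)}.$$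
   Context: $[m]=\{1,\dots,m\}$. Permutations are written in one-line notation $\pi=[\pi(1),\dots,\pi(n)]$ and multiplied as functions: $(\sigma\tau)(k)=\sigma(\tau(k))$; $s_i=(i,i+1)$. Symmetric group statistics: $\mathrm{Des}_S(\pi)=\{i\in[n-1]:\pi(i)>\pi(i+1)\}$; $\mathrm{rmaj}_{S_n}(\pi)=\sum_{i\in\mathrm{Des}_S(\pi)}(n-i)$; $\ell_S(\pi)$ is the number of inversions of $\pi$ (pairs $i<j$ with $\pi(i)>\pi(j)$); $\mathrm{Del}_S(w)=\{1<i\le n:\ w(i)<w(j)\text{ for all }j<i\}$ (left-to-right minima other than position 1). Alternating group: in $S_{n+1}$ put $a_i=s_1s_{i+1}=(1,2)(i+1,i+2)$ for $1\le i\le n-1$. For $1\le j\le n-1$ let $R^A_j=\{1,\ a_j,\ a_ja_{j-1},\ \dots,\ a_j\cdots a_2,\ a_j\cdots a_2a_1,\ a_j\cdots a_2a_1^{-1}\}$ (so $R^A_1=\{1,a_1,a_1^{-1}\}$), each element regarded as the displayed word. Every $v\in A_{n+1}$ has a unique factorization $v=v_1\cdots v_{n-1}$ with $v_j\in R^A_j$ (the $A$ canonical presentation); $\ell_A(v)$ is the total number of letters $a_i^{\pm1}$ in this word. $\mathrm{Des}_A(\sigma)=\{1\le i\le n-1:\ \ell_A(\sigma)\ge\ell_A(\sigma a_i)\}$ and $\mathrm{rmaj}_{A_{n+1}}(\sigma)=\sum_{i\in\mathrm{Des}_A(\sigma)}(n-i)$. For $w\in A_{n+1}$ (one-line notation $[b_1,\dots,b_{n+1}]$),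 $\mathrm{Del}_A(w)$ is the set of positions $i$ with $3\le i\le n+1$ such that $|\{j<i: b_j<b_i\}|\le 1$. *)

theory Defs
  imports "HOL-Combinatorics.Permutations" "HOL-Computational_Algebra.Polynomial"
begin

(* Permutations of [m] are functions nat => nat with "permutes {1..m}"; since these fix every
   point outside [m], the size is an explicit parameter of the statistics. *)

definition sym_perms :: "nat \<Rightarrow> (nat \<Rightarrow> nat) set" where
  "sym_perms m = {p. p permutes {1..m}}"

definition alt_perms :: "nat \<Rightarrow> (nat \<Rightarrow> nat) set" where
  "alt_perms m = {p. p permutes {1..m} \<and> evenperm p}"

definition Des_S :: "nat \<Rightarrow> (nat \<Rightarrow> nat) \<Rightarrow> nat set" where
  "Des_S n p = {i \<in> {1..n - 1}. p i > p (i + 1)}"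

definition rmaj_S :: "nat \<Rightarrow> (nat \<Rightarrow> nat) \<Rightarrow> nat" where
  "rmaj_S n p = (\<Sum>i\<in>Des_S n p. n - i)"

definition ell_S :: "nat \<Rightarrow> (nat \<Rightarrow> nat) \<Rightarrow> nat" where
  "ell_S n p = card {(i, j). 1 \<le> i \<and> i < j \<and> j \<le> n \<and> p i > p j}"

definition Del_S :: "nat \<Rightarrow> (nat \<Rightarrow> nat) \<Rightarrow> nat set" where
  "Del_S n w = {i. 1 < i \<and> i \<le> n \<and> (\<forall>j\<in>{1..<i}. w i < w j)}"

definition gen_s :: "nat \<Rightarrow> nat \<Rightarrow> nat" where
  "gen_s i = transpose i (i + 1)"

definition gen_a :: "nat \<Rightarrow> nat \<Rightarrow> nat" where
  "gen_a i = gen_s 1 \<circ> gen_s (i + 1)"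

(* A letter (i, True) stands for a_i, and (i, False) for its inverse. *)

type_synonym A_word = "(nat \<times> bool) list"

definition letter_perm :: "nat \<times> bool \<Rightarrow> nat \<Rightarrow> nat" where
  "letter_perm x = (if snd x then gen_a (fst x) else inv (gen_a (fst x)))"

definition word_perm :: "A_word \<Rightarrow> nat \<Rightarrow> nat" where
  "word_perm w = foldr (\<lambda>x p. letter_perm x \<circ> p) w id"

definition desc_word :: "nat \<Rightarrow> nat \<Rightarrow> A_word" where
  "desc_word j k = map (\<lambda>i. (i, True)) (rev [k..<j + 1])"

(* desc_word j k is the word a_j a_(j-1) ... a_k, which is empty for k = j + 1. *)

definition R_A :: "nat \<Rightarrow> A_word set" where
  "R_A j = {desc_word j k | k. 1 \<le> k \<and> k \<le> j + 1} \<union> {desc_word j 2 @ [(1, False)]}"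

(* List positions start at 0, so ws ! j is the factor v_(j+1). *)

definition A_presentation :: "nat \<Rightarrow> (nat \<Rightarrow> nat) \<Rightarrow> A_word list \<Rightarrow> bool" where
  "A_presentation n v ws \<longleftrightarrow>
     length ws = n - 1 \<and> (\<forall>j<n - 1. ws ! j \<in> R_A (j + 1)) \<and> word_perm (concat ws) = v"

(* Meaningful for v in alt_perms (n + 1), where the presentation exists and is unique. *)

definition ell_A :: "nat \<Rightarrow> (nat \<Rightarrow> nat) \<Rightarrow> nat" where
  "ell_A n v = length (concat (THE ws. A_presentation n v ws))"

definition Des_A :: "nat \<Rightarrow> (nat \<Rightarrow> nat) \<Rightarrow> nat set" where
  "Des_A n p = {i \<in> {1..n - 1}. ell_A n p \<ge> ell_A n (p \<circ> gen_a i)}"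

definition rmaj_A :: "nat \<Rightarrow> (nat \<Rightarrow> nat) \<Rightarrow> nat" where
  "rmaj_A n p = (\<Sum>i\<in>Des_A n p. n - i)"

definition Del_A :: "nat \<Rightarrow> (nat \<Rightarrow> nat) \<Rightarrow> nat set" where
  "Del_A n w = {i \<in> {3..n + 1}. card {j \<in> {1..<i}. w j < w i} \<le> 1}"

end

theory Submission
  imports Defs "HOL-Combinatorics.Multiset_Permutations"
begin

text \<open>
  Part (1): Foata's second fundamental transformation, read from the left, maps the word \<open>x w\<close> to
  \<open>x\<close> followed by the image of \<open>w\<close> in which the blocks determined by \<open>x\<close> are rotated. A rotation
  changes neither the subword of letters below \<open>x\<close> nor that of letters above \<open>x\<close>, so the bijection
  preserves the relative order of \<open>i\<close> and \<open>i + 1\<close> and the set of left-to-right minima, which encode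
  \<open>Des_S\<close> and \<open>Del_S\<close> of the inverse, while it turns \<open>rmaj\<close> into the inversion number.

  Part (2): one pass of bubble sort, carrying the current minimum to the right, followed by deleting
  the final entry 1 and lowering all others by 1, is a map from \<open>S(n+1)\<close> to \<open>S(n)\<close>. It commutes with
  inversion and takes the \<open>A\<close>-statistics to the \<open>S\<close>-statistics (with \<open>Del\<close> shifted by 1). Its fibre in
  \<open>A(n+1)\<close> over \<open>p\<close> has \<open>2 ^ card (Del_S n (inv p))\<close> elements, so (2) is a weighted form of (1).
\<close>

subsection \<open>Foata's bijection on words\<close>

declare upt_Suc [simp del]

fun inv_list :: "nat list \<Rightarrow> nat" where
  "inv_list [] = 0"
| "inv_list (x # w) = length (filter (\<lambda>y. y < x) w) + inv_list w"

text \<open>When position \<open>i\<close> of a word of length \<open>n\<close> is peeled off,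
  \<open>length w\<close> equals n - i, the weight of a descent at \<open>i\<close>.\<close>

fun rmaj_list :: "nat list \<Rightarrow> nat" where
  "rmaj_list [] = 0"
| "rmaj_list (x # w) = (if w \<noteq> [] \<and> hd w < x then length w else 0) + rmaj_list w"

fun before :: "'a list \<Rightarrow> ('a \<times> 'a) set" where
  "before [] = {}"
| "before (x # w) = {x} \<times> set w \<union> before w"

definition inv_descents :: "nat list \<Rightarrow> nat set" where
  "inv_descents w = {i. (Suc i, i) \<in> before w}"

text \<open>In a word without repetitions, a letter is smaller than everything to its left iff it
  stands before every smaller letter. This form involves only the relative order of letters.\<close>

definition lr_minima :: "nat list \<Rightarrow> nat set" where
  "lr_minima w = {i \<in> set w. \<forall>j\<in>set w. j < i \<longrightarrow> (i, j) \<in> before w}"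

text \<open>
  In \<open>carry P c w\<close>, the word \<open>c # w\<close> is cut before every letter satisfying \<open>P\<close>, and the first letter
  of each block is moved to the end of its block.
\<close>

fun carry :: "('a \<Rightarrow> bool) \<Rightarrow> 'a \<Rightarrow> 'a list \<Rightarrow> 'a list" where
  "carry P c [] = [c]"
| "carry P c (y # w) = (if P y then c # carry P y w else y # carry P c w)"

text \<open>Cutting before every letter on the same side of \<open>x\<close> as the first one makes
  each block a single such letter followed by letters from the other side.\<close>

fun rotate_blocks :: "nat \<Rightarrow> nat list \<Rightarrow> nat list" where
  "rotate_blocks x [] = []"
| "rotate_blocks x (c # w) = carry (\<lambda>y. (y < x) = (c < x)) c w"

fun foata :: "nat list \<Rightarrow> nat list" where
  "foata [] = []"
| "foata (x # w) = x # rotate_blocks x (foata w)"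

section \<open>Letters and one-sided subwords under block rotation\<close>

lemma mset_carry: "mset (carry P c w) = mset (c # w)"
  by (induction w arbitrary: c) auto

lemma length_carry [simp]: "length (carry P c w) = Suc (length w)"
  by (metis mset_carry size_mset length_Cons)

lemma mset_rotate_blocks [simp]: "mset (rotate_blocks x w) = mset w"
  by (cases w) (simp_all add: mset_carry)

lemma mset_foata [simp]: "mset (foata w) = mset w"
  by (induction w) simp_all

lemma set_rotate_blocks [simp]: "set (rotate_blocks x w) = set w"
  by (metis mset_rotate_blocks set_mset_mset)

lemma set_foata [simp]: "set (foata w) = set w"
  by (metis mset_foata set_mset_mset)

lemma length_foata [simp]: "length (foata w) = length w"
  by (metis mset_foata size_mset)

lemma distinct_foata [simp]: "distinct (foata w) = distinct w"
  by (metis mset_foata mset_eq_imp_distinct_iff)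

lemma length_filter_mset: "mset v = mset w \<Longrightarrow> length (filter P v) = length (filter P w)"
  by (metis mset_filter size_mset)

text \<open>The moved letter is the only one of its block satisfying \<open>P\<close>, so it jumps
  only over letters violating \<open>P\<close>, and neither class is reordered internally.\<close>

lemma filter_carry: "P c \<Longrightarrow> filter P (carry P c w) = c # filter P w"
  by (induction w arbitrary: c) auto

lemma filter_not_carry: "P c \<Longrightarrow> filter (\<lambda>y. \<not> P y) (carry P c w) = filter (\<lambda>y. \<not> P y) w"
  by (induction w arbitrary: c) auto

lemma filter_rotate_blocks:
  "filter (\<lambda>y. y < x) (rotate_blocks x w) = filter (\<lambda>y. y < x) w"
  "filter (\<lambda>y. \<not> y < x) (rotate_blocks x w) = filter (\<lambda>y. \<not> y < x) w"
proof -
  have "filter (\<lambda>y. y < x) (rotate_blocks x w) = filter (\<lambda>y. y < x) w \<and>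
    filter (\<lambda>y. \<not> y < x) (rotate_blocks x w) = filter (\<lambda>y. \<not> y < x) w"
  proof (cases w)
    case (Cons c z)
    let ?P = "\<lambda>y. (y < x) = (c < x)"
    show ?thesis
      using filter_carry[of ?P c z] filter_not_carry[of ?P c z] unfolding Cons
      by (cases "c < x") simp_all
  qed simp
  then show "filter (\<lambda>y. y < x) (rotate_blocks x w) = filter (\<lambda>y. y < x) w"
    "filter (\<lambda>y. \<not> y < x) (rotate_blocks x w) = filter (\<lambda>y. \<not> y < x) w" by auto
qed

text \<open>The first letter of the output satisfies \<open>P\<close> exactly when the block of the
  carried letter ends at once, so reading the output from the left undoes the rotation.\<close>

lemma carry_inject:
  "\<lbrakk>carry P c w = carry P d v; P c; P d\<rbrakk> \<Longrightarrow> c = d \<and> w = v"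
proof (induction w arbitrary: c d v)
  case Nil
  then have "length v = 0" by (metis length_carry list.size(3) nat.inject)
  with Nil show ?case by simp
next
  case (Cons y w)
  then have "length v = Suc (length w)" by (metis length_carry length_Cons nat.inject)
  then obtain z u where v: "v = z # u" by (cases v) auto
  show ?case
    using Cons.prems Cons.IH[of y z u] Cons.IH[of c d u]
    by (auto simp: v split: if_splits)
qed

text \<open>The last block ends with its former first letter. The last letter of a rotated word
  therefore reveals on which side of \<open>x\<close> the cutting letters lie.\<close>

lemma last_carry: "P c \<Longrightarrow> P (last (carry P c w))"
proof (induction w arbitrary: c)
  case (Cons y w)
  have "carry P a w \<noteq> []" for a by (metis length_carry list.size(3) nat.distinct(1))
  then show ?case using Cons by auto
qed simp

lemma rotate_blocks_inject:
  assumes "rotate_blocks x v = rotate_blocks x w"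
  shows "v = w"
proof -
  have len: "length v = length w" by (metis assms mset_rotate_blocks size_mset)
  show ?thesis
  proof (cases v)
    case Nil
    then show ?thesis using len by simp
  next
    case (Cons c v')
    then obtain d w' where w: "w = d # w'" using len by (cases w) auto
    have "(d < x) = (c < x)"
      using assms last_carry[of "\<lambda>y. (y < x) = (c < x)" c v']
        last_carry[of "\<lambda>y. (y < x) = (d < x)" d w'] unfolding Cons w by simp
    then show ?thesis
      using assms carry_inject[of "\<lambda>y. (y < x) = (c < x)" c v' d w'] unfolding Cons w by simp
  qed
qed

lemma inj_foata: "inj foata"
proof (rule injI)
  show "foata v = foata w \<Longrightarrow> v = w" for v w
  proof (induction v arbitrary: w)
    case Nil
    then show ?case by (cases w) auto
  next
    case (Cons x v)
    then show ?case by (cases w) (auto dest: rotate_blocks_inject)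
  qed
qed

lemma bij_betw_foata: "finite A \<Longrightarrow> bij_betw foata (permutations_of_set A) (permutations_of_set A)"
proof (rule bij_betw_imageI)
  assume "finite A"
  show inj: "inj_on foata (permutations_of_set A)"
    using inj_foata by (rule inj_on_subset) simp
  have "foata ` permutations_of_set A \<subseteq> permutations_of_set A"
    by (auto simp: permutations_of_set_def)
  then show "foata ` permutations_of_set A = permutations_of_set A"
    using inj by (simp add: endo_inj_surj)
qed

text \<open>Each letter that is at least \<open>x\<close> is overtaken by exactly one smaller
  letter, the head of its block, and this creates one inversion.\<close>

lemma inv_list_carry_less:
  "c < x \<Longrightarrow> inv_list (carry (\<lambda>y. y < x) c w) =
     inv_list (c # w) + length (filter (\<lambda>y. \<not> y < x) w)"
proof (induction w arbitrary: c)
  case (Cons y w)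
  have "length (filter (\<lambda>z. z < a) (carry P b w)) = length (filter (\<lambda>z. z < a) (b # w))" for a b P
    by (intro length_filter_mset mset_carry)
  then show ?case using Cons.prems Cons.IH[of c] Cons.IH[of y] by (cases "y < x") auto
qed simp

text \<open>Dually, each letter below \<open>x\<close> loses its inversion with the head of its
  block. The lost inversions are added on the left to avoid truncated subtraction.\<close>

lemma inv_list_carry_ge:
  "\<not> c < x \<Longrightarrow> inv_list (carry (\<lambda>y. \<not> y < x) c w) + length (filter (\<lambda>y. y < x) w) =
     inv_list (c # w)"
proof (induction w arbitrary: c)
  case (Cons y w)
  have "length (filter (\<lambda>z. z < a) (carry P b w)) = length (filter (\<lambda>z. z < a) (b # w))" for a b P
    by (intro length_filter_mset mset_carry)
  then show ?case using Cons.prems Cons.IH[of c] Cons.IH[of y] by (cases "y < x") auto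
qed simp

lemma hd_foata [simp]: "hd (foata w) = hd w"
  by (cases w) auto

text \<open>Prepending \<open>x\<close> adds one inversion per letter below \<open>x\<close>. If the
  head of \<open>w\<close> is below \<open>x\<close>, rotation adds one per remaining letter, in
  total \<open>length w\<close>, the weight of the new descent; otherwise rotation cancels the
  contribution of \<open>x\<close>.\<close>

lemma inv_list_foata: "distinct w \<Longrightarrow> inv_list (foata w) = rmaj_list w"
proof (induction w)
  case (Cons x w)
  show ?case
  proof (cases "foata w")
    case Nil
    then have "w = []" by (metis length_foata length_0_conv)
    then show ?thesis by simp
  next
    case (Cons c z)
    have w: "w \<noteq> []" "hd w = c" "length w = Suc (length z)"
      using Cons hd_foata[of w] length_foata[of w] by auto
    have f: "length (filter (\<lambda>y. y < x) (rotate_blocks x (foata w))) =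
        length (filter (\<lambda>y. y < x) (c # z))"
      by (intro length_filter_mset) (simp add: local.Cons mset_carry)
    have IH: "rmaj_list w = inv_list (c # z)" using Cons.IH Cons.prems local.Cons by simp
    have s: "length (filter (\<lambda>y. y < x) z) + length (filter (\<lambda>y. \<not> y < x) z) = length z"
      by (rule sum_length_filter_compl)
    show ?thesis
    proof (cases "c < x")
      case True
      then show ?thesis using f IH s w inv_list_carry_less[of c x z] local.Cons by simp
    next
      case False
      then show ?thesis using f IH s w inv_list_carry_ge[of c x z] local.Cons by simp
    qed
  qed
qed simp

section \<open>Relative order of letters under block rotation\<close>

lemma before_subset: "before w \<subseteq> set w \<times> set w"
  by (induction w) auto

lemma before_filter: "before (filter P w) = before w \<inter> Collect P \<times> Collect P"
  by (induction w) auto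

text \<open>Two letters on the same side of \<open>x\<close> belong to a common subword that
  rotation leaves unchanged.\<close>

lemma before_rotate_blocks:
  assumes "(i < x) = (j < x)"
  shows "(i, j) \<in> before (rotate_blocks x w) \<longleftrightarrow> (i, j) \<in> before w"
proof -
  have "before (rotate_blocks x w) \<inter> {y. y < x} \<times> {y. y < x} = before w \<inter> {y. y < x} \<times> {y. y < x}"
    by (simp only: before_filter[symmetric] filter_rotate_blocks)
  moreover have "before (rotate_blocks x w) \<inter> {y. \<not> y < x} \<times> {y. \<not> y < x} =
      before w \<inter> {y. \<not> y < x} \<times> {y. \<not> y < x}"
    by (simp only: before_filter[symmetric] filter_rotate_blocks)
  ultimately show ?thesis using assms by blast
qed

lemma inv_descents_Cons:
  "inv_descents (x # w) = {i. Suc i = x \<and> i \<in> set w} \<union> inv_descents w"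
  by (auto simp: inv_descents_def)

lemma inv_descents_rotate_blocks:
  assumes "x \<notin> set w"
  shows "inv_descents (rotate_blocks x w) = inv_descents w"
proof -
  \<comment> \<open>Consecutive letters \<open>i\<close> and \<open>Suc i\<close> are separated by
    \<open>x\<close> only if \<open>Suc i = x\<close>, and \<open>x\<close> does not occur in
    \<open>w\<close>.\<close>
  have "(Suc i, i) \<in> before (rotate_blocks x w) \<longleftrightarrow> (Suc i, i) \<in> before w" for i
  proof (cases "Suc i = x")
    case True
    then show ?thesis
      using assms before_subset[of w] before_subset[of "rotate_blocks x w"] by auto
  next
    case False
    then show ?thesis by (intro before_rotate_blocks) auto
  qed
  then show ?thesis by (simp add: inv_descents_def)
qed

lemma inv_descents_foata: "distinct w \<Longrightarrow> inv_descents (foata w) = inv_descents w"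
  by (induction w) (simp_all add: inv_descents_Cons inv_descents_rotate_blocks)

lemma lr_minima_Cons:
  assumes "x \<notin> set w"
  shows "lr_minima (x # w) = insert x {y \<in> lr_minima w. y < x}"
  using assms before_subset[of w] by (auto simp: lr_minima_def)

text \<open>Whether \<open>y\<close> is a minimum depends on its order relative to smaller letters
  only; for \<open>y < x\<close> all of these are below \<open>x\<close>.\<close>

lemma lr_minima_rotate_blocks:
  "{y \<in> lr_minima (rotate_blocks x w). y < x} = {y \<in> lr_minima w. y < x}"
  using before_rotate_blocks[of _ x _ w] by (auto simp: lr_minima_def)

lemma lr_minima_foata: "distinct w \<Longrightarrow> lr_minima (foata w) = lr_minima w"
  by (induction w) (simp_all add: lr_minima_Cons lr_minima_rotate_blocks)

lemma foata_equidistribution: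
  assumes "finite A"
  shows "(\<Sum>w\<in>permutations_of_set A. F (inv_descents w) (lr_minima w) (rmaj_list w)) =
         (\<Sum>w\<in>permutations_of_set A. F (inv_descents w) (lr_minima w) (inv_list w))"
proof -
  have "(\<Sum>w\<in>permutations_of_set A. F (inv_descents w) (lr_minima w) (rmaj_list w)) =
      (\<Sum>w\<in>permutations_of_set A.
        F (inv_descents (foata w)) (lr_minima (foata w)) (inv_list (foata w)))"
    by (intro sum.cong refl)
      (simp add: permutations_of_set_def inv_list_foata inv_descents_foata lr_minima_foata)
  also have "\<dots> = (\<Sum>w\<in>permutations_of_set A. F (inv_descents w) (lr_minima w) (inv_list w))"
    by (rule sum.reindex_bij_betw[OF bij_betw_foata[OF assms]])
  finally show ?thesis .
qed

section \<open>From permutations to their one-line words\<close>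

definition one_line :: "nat \<Rightarrow> (nat \<Rightarrow> nat) \<Rightarrow> nat list" where
  "one_line n p = map p [1..<Suc n]"

lemma bij_betw_one_line: "bij_betw (one_line n) (sym_perms n) (permutations_of_set {1..n})"
proof (rule bij_betw_imageI)
  show inj: "inj_on (one_line n) (sym_perms n)"
  proof (rule inj_onI)
    fix p q
    assume p: "p \<in> sym_perms n" and q: "q \<in> sym_perms n" and eq: "one_line n p = one_line n q"
    show "p = q"
    proof
      fix i
      show "p i = q i"
      proof (cases "i \<in> {1..n}")
        case True
        then show ?thesis using eq by (auto simp: one_line_def)
      next
        case False
        then show ?thesis using p q by (simp add: sym_perms_def permutes_not_in)
      qed
    qed
  qed
  have "one_line n ` sym_perms n \<subseteq> permutations_of_set {1..n}"
  proof
    fix w assume "w \<in> one_line n ` sym_perms n"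
    then obtain p where p: "p permutes {1..n}" and w: "w = map p [1..<Suc n]"
      by (auto simp: sym_perms_def one_line_def)
    have "set w = {1..n}" using permutes_image[OF p]
      by (simp add: w atLeastLessThanSuc_atLeastAtMost)
    moreover have "distinct w" using permutes_inj[OF p]
      by (auto simp: w distinct_map intro: inj_on_subset)
    ultimately show "w \<in> permutations_of_set {1..n}" by (simp add: permutations_of_set_def)
  qed
  moreover have "card (permutations_of_set {1..n}) = card (sym_perms n)"
    by (simp add: sym_perms_def card_permutations[of _ n])
  ultimately show "one_line n ` sym_perms n = permutations_of_set {1..n}"
    using inj by (simp add: card_subset_eq card_image)
qed

lemma inv_list_upt:
  "inv_list (map p [a..<b]) = card {(i, j). a \<le> i \<and> i < j \<and> j < b \<and> p j < p i}"
proof (induction "b - a" arbitrary: a)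
  case 0
  then have empty: "{(i, j). a \<le> i \<and> i < j \<and> j < b \<and> p j < p i} = {}" by auto
  show ?case unfolding empty using 0 by simp
next
  case (Suc d)
  then have ab: "a < b" by simp
  let ?I = "\<lambda>a. {(i, j). a \<le> i \<and> i < j \<and> j < b \<and> p j < p i}"
  let ?J = "{j \<in> {Suc a..<b}. p j < p a}"
  have "?I a = Pair a ` ?J \<union> ?I (Suc a)"
    by (auto simp: image_iff) (metis Suc_leI le_neq_implies_less)+
  moreover have "finite (?I (Suc a))"
    by (rule finite_subset[of _ "{..<b} \<times> {..<b}"]) auto
  moreover have "Pair a ` ?J \<inter> ?I (Suc a) = {}" by auto
  ultimately have "card (?I a) = card ?J + card (?I (Suc a))"
    by (simp add: card_Un_disjoint card_image inj_on_def)
  moreover have "length (filter (\<lambda>y. y < p a) (map p [Suc a..<b])) = card ?J"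
  proof -
    have "card (set (filter (\<lambda>j. p j < p a) [Suc a..<b])) =
        length (filter (\<lambda>j. p j < p a) [Suc a..<b])"
      by (intro distinct_card) simp
    moreover have "set (filter (\<lambda>j. p j < p a) [Suc a..<b]) = ?J" by auto
    ultimately show ?thesis by (simp only: filter_map comp_def length_map)
  qed
  ultimately show ?case using Suc ab by (simp add: upt_conv_Cons)
qed

lemma ell_S_one_line: "ell_S n p = inv_list (one_line n p)"
  by (simp add: ell_S_def one_line_def inv_list_upt less_Suc_eq_le)

lemma rmaj_list_upt:
  "rmaj_list (map p [a..<Suc n]) = (\<Sum>i\<in>{i. a \<le> i \<and> i < n \<and> p (Suc i) < p i}. n - i)"
proof (induction "Suc n - a" arbitrary: a)
  case 0
  then have "{i. a \<le> i \<and> i < n \<and> p (Suc i) < p i} = {}" by auto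
  then show ?case using 0 by simp
next
  case (Suc d)
  then have an: "a \<le> n" by simp
  let ?I = "\<lambda>a. {i. a \<le> i \<and> i < n \<and> p (Suc i) < p i}"
  have I: "?I a = (if a < n \<and> p (Suc a) < p a then insert a (?I (Suc a)) else ?I (Suc a))"
    by (auto simp: le_less Suc_le_eq)
  have "(\<Sum>i\<in>?I a. n - i) = (if a < n \<and> p (Suc a) < p a then n - a else 0) + (\<Sum>i\<in>?I (Suc a). n - i)"
    unfolding I by simp
  moreover have "rmaj_list (map p [a..<Suc n]) =
      (if a < n \<and> p (Suc a) < p a then n - a else 0) + rmaj_list (map p [Suc a..<Suc n])"
    using an by (subst upt_conv_Cons) (auto simp: hd_map)
  ultimately show ?case using Suc by simp
qed

lemma rmaj_S_one_line: "rmaj_S n p = rmaj_list (one_line n p)"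
proof -
  have "Des_S n p = {i. 1 \<le> i \<and> i < n \<and> p (Suc i) < p i}" by (auto simp: Des_S_def)
  then show ?thesis by (simp add: rmaj_S_def one_line_def rmaj_list_upt)
qed

lemma before_upt:
  "before (map p [a..<b]) = map_prod p p ` {(i, j). a \<le> i \<and> i < j \<and> j < b}"
proof (induction "b - a" arbitrary: a)
  case 0
  then show ?case by auto
next
  case (Suc d)
  then have upt: "[a..<b] = a # [Suc a..<b]" by (simp add: upt_conv_Cons)
  have "{(i, j). a \<le> i \<and> i < j \<and> j < b} =
      {a} \<times> {Suc a..<b} \<union> {(i, j). Suc a \<le> i \<and> i < j \<and> j < b}"
    by auto
  then show ?case using Suc by (auto simp: upt image_Un)
qed

lemma before_one_line:
  assumes "p permutes {1..n}" "x \<in> {1..n}" "y \<in> {1..n}"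
  shows "(x, y) \<in> before (one_line n p) \<longleftrightarrow> inv p x < inv p y"
proof
  assume "(x, y) \<in> before (one_line n p)"
  then show "inv p x < inv p y"
    using permutes_inverses(2)[OF assms(1)] by (auto simp: one_line_def before_upt)
next
  assume less: "inv p x < inv p y"
  have "inv p x \<in> {1..n}" "inv p y \<in> {1..n}"
    using assms permutes_in_image[OF permutes_inv[OF assms(1)]] by auto
  moreover have "p (inv p x) = x" "p (inv p y) = y"
    using permutes_inverses(1)[OF assms(1)] by auto
  ultimately show "(x, y) \<in> before (one_line n p)"
    unfolding one_line_def before_upt using less
    by (intro image_eqI[of _ _ "(inv p x, inv p y)"]) auto
qed

lemma set_one_line: "p permutes {1..n} \<Longrightarrow> set (one_line n p) = {1..n}"
  using permutes_image[of p "{1..n}"] by (simp add: one_line_def atLeastLessThanSuc_atLeastAtMost)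

lemma Des_S_inv_one_line:
  assumes p: "p permutes {1..n}"
  shows "Des_S n (inv p) = inv_descents (one_line n p)"
proof -
  have "i \<in> {1..n - 1} \<longleftrightarrow> i \<in> {1..n} \<and> Suc i \<in> {1..n}" for i by auto
  then show ?thesis
    using before_one_line[OF p] before_subset[of "one_line n p"]
    unfolding set_one_line[OF p] Des_S_def inv_descents_def by auto
qed

text \<open>The letter 1 is vacuously a left-to-right minimum, whereas \<open>Del_S\<close> leaves
  out position 1.\<close>

lemma Del_S_inv_one_line:
  assumes p: "p permutes {1..n}"
  shows "Del_S n (inv p) = lr_minima (one_line n p) - {1}"
  using before_one_line[OF p] unfolding Del_S_def lr_minima_def set_one_line[OF p] by auto

text \<open>The function \<open>F\<close> is arbitrary so that it can be an indicator for part (1)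
  and an indicator weighted by a power of 2 for part (2).\<close>

lemma S_equidistribution:
  "(\<Sum>p\<in>sym_perms n. F (Des_S n (inv p)) (Del_S n (inv p)) (rmaj_S n p)) =
   (\<Sum>p\<in>sym_perms n. F (Des_S n (inv p)) (Del_S n (inv p)) (ell_S n p))"
proof -
  let ?G = "\<lambda>r w. F (inv_descents w) (lr_minima w - {1}) (r w)"
  have "(\<Sum>p\<in>sym_perms n. F (Des_S n (inv p)) (Del_S n (inv p)) (rmaj_S n p)) =
      (\<Sum>p\<in>sym_perms n. ?G rmaj_list (one_line n p))"
    by (intro sum.cong refl)
      (simp add: sym_perms_def Des_S_inv_one_line Del_S_inv_one_line rmaj_S_one_line)
  also have "\<dots> = (\<Sum>w\<in>permutations_of_set {1..n}. ?G rmaj_list w)"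
    by (rule sum.reindex_bij_betw[OF bij_betw_one_line])
  also have "\<dots> = (\<Sum>w\<in>permutations_of_set {1..n}. ?G inv_list w)"
    using foata_equidistribution[of "{1..n}" "\<lambda>D L. F D (L - {1})"] by simp
  also have "\<dots> = (\<Sum>p\<in>sym_perms n. ?G inv_list (one_line n p))"
    by (rule sum.reindex_bij_betw[OF bij_betw_one_line, symmetric])
  also have "\<dots> = (\<Sum>p\<in>sym_perms n. F (Des_S n (inv p)) (Del_S n (inv p)) (ell_S n p))"
    by (intro sum.cong refl)
      (simp add: sym_perms_def Des_S_inv_one_line Del_S_inv_one_line ell_S_one_line)
  finally show ?thesis .
qed

subsection \<open>The covering map\<close>

text \<open>
  Here \<open>Min (v ` {1..i})\<close> is the entry carried when the pass reaches position \<open>i + 1\<close>. If \<open>v\<close> fixes all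
  points above \<open>n + 1\<close>, then \<open>bub v\<close> fixes all points above \<open>n\<close>, so the size need not be a parameter.
\<close>

definition bub :: "(nat \<Rightarrow> nat) \<Rightarrow> nat \<Rightarrow> nat" where
  "bub v i = (if i = 0 then 0 else max (Min (v ` {1..i})) (v (Suc i)) - 1)"

section \<open>Adjacent transpositions and the bubble pass\<close>

lemma gen_s_apply: "gen_s i k = (if k = i then Suc i else if k = Suc i then i else k)"
  by (simp add: gen_s_def transpose_def)

lemma gen_s_permutes: "\<lbrakk>1 \<le> i; Suc i \<le> m\<rbrakk> \<Longrightarrow> gen_s i permutes {1..m}"
  unfolding gen_s_def by (intro permutes_swap_id) auto

lemma gen_s_comp [simp]: "gen_s i \<circ> gen_s i = id"
  by (auto simp: gen_s_apply)

lemma gen_s_image: "1 \<le> i \<Longrightarrow> Suc i \<le> m \<Longrightarrow> gen_s i ` {1..m} = {1..m}"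
  by (intro permutes_image gen_s_permutes)

lemma prefix_Min_Suc:
  fixes v :: "nat \<Rightarrow> nat"
  assumes "1 \<le> i"
  shows "Min (v ` {1..Suc i}) = min (Min (v ` {1..i})) (v (Suc i))"
proof -
  have "v ` {1..Suc i} = insert (v (Suc i)) (v ` {1..i})"
    using assms by (simp add: atLeastAtMostSuc_conv)
  then show ?thesis using assms by (simp add: min.commute)
qed

text \<open>Only the prefix of length \<open>i\<close> separates the two swapped positions; every
  other prefix keeps its set of entries.\<close>

lemma prefix_Min_comp_gen_s:
  assumes "1 \<le> i" "k \<noteq> i"
  shows "Min ((v \<circ> gen_s i) ` {1..k}) = Min (v ` {1..k})"
proof -
  have "gen_s i ` {1..k} = {1..k}"
  proof (cases "k < i")
    case True
    then show ?thesis by (auto simp: gen_s_apply image_iff)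
  next
    case False
    then show ?thesis using assms by (intro gen_s_image) auto
  qed
  then show ?thesis by (simp only: image_comp[symmetric])
qed

text \<open>The first comparison of the pass sorts the first two entries, so their initial order is
  lost.\<close>

lemma bub_comp_gen_s_1: "bub (v \<circ> gen_s 1) = bub v"
proof
  fix i
  show "bub (v \<circ> gen_s 1) i = bub v i"
  proof (cases "i \<le> 1")
    case True
    then have "i = 0 \<or> i = 1" by auto
    then show ?thesis by (auto simp: bub_def gen_s_apply max.commute)
  next
    case False
    then show ?thesis
      using prefix_Min_comp_gen_s[of 1 i v] by (simp add: bub_def gen_s_apply)
  qed
qed

text \<open>Let \<open>h\<close> be the carried minimum and \<open>b\<close>, \<open>c\<close> the
  next two entries. If both are below \<open>h\<close>, the pass leaves \<open>h\<close> and
  \<open>max b c\<close> in either order of \<open>b\<close>, \<open>c\<close>. Otherwise it leaves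
  \<open>max h b\<close> and \<open>max h c\<close>, which are exchanged along with \<open>b\<close>
  and \<open>c\<close>.\<close>

lemma bub_comp_gen_s:
  assumes "1 \<le> i"
  shows "bub (v \<circ> gen_s (Suc i)) =
    (if v (Suc i) < Min (v ` {1..i}) \<and> v (Suc (Suc i)) < Min (v ` {1..i}) then bub v
     else bub v \<circ> gen_s i)"
proof
  fix k
  define h where "h = Min (v ` {1..i})"
  define b where "b = v (Suc i)"
  define c where "c = v (Suc (Suc i))"
  note defs = h_def b_def c_def
  let ?u = "v \<circ> gen_s (Suc i)"
  have same: "Min (?u ` {1..k}) = Min (v ` {1..k})" if "k \<noteq> Suc i" for k
    using assms that by (intro prefix_Min_comp_gen_s) auto
  have u: "?u (Suc i) = c" "?u (Suc (Suc i)) = b" by (simp_all add: gen_s_apply defs)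
  have h: "Min (v ` {1..i}) = h" "Min (?u ` {1..i}) = h"
    using same[of i] unfolding h_def by auto
  have hb: "Min (v ` {1..Suc i}) = min h b" and hc: "Min (?u ` {1..Suc i}) = min h c"
    using prefix_Min_Suc[OF assms, of v] prefix_Min_Suc[OF assms, of ?u] unfolding u h
    by (simp_all only: b_def)
  have i: "bub v i = max h b - 1" "bub ?u i = max h c - 1"
    unfolding bub_def u h using assms by (simp_all only: b_def) simp_all
  have Si: "bub v (Suc i) = max (min h b) c - 1" "bub ?u (Suc i) = max (min h c) b - 1"
    unfolding bub_def u hb hc by (simp_all only: c_def) simp_all
  have "bub ?u k = (if b < h \<and> c < h then bub v k else bub v (gen_s i k))"
  proof -
    have g: "gen_s i i = Suc i" "gen_s i (Suc i) = i" by (simp_all add: gen_s_apply)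
    consider "k = i" | "k = Suc i" | "k \<noteq> i" "k \<noteq> Suc i" by blast
    then show ?thesis
    proof cases
      case 1
      show ?thesis unfolding 1 g i Si by auto
    next
      case 2
      show ?thesis unfolding 2 g i Si by auto
    next
      case 3
      then have fixed: "gen_s (Suc i) (Suc k) = Suc k" "gen_s i k = k"
        by (simp_all add: gen_s_apply)
      show ?thesis unfolding fixed if_cancel bub_def same[OF 3(2)] comp_apply[of _ _ "Suc k"] ..
    qed
  qed
  then show "bub ?u k = (if v (Suc i) < Min (v ` {1..i}) \<and> v (Suc (Suc i)) < Min (v ` {1..i})
      then bub v else bub v \<circ> gen_s i) k"
    by (simp add: defs)
qed

section \<open>The pass gives permutations and commutes with inversion\<close>

lemma permutes_atMost_le: "v permutes {1..m} \<Longrightarrow> i \<le> m \<Longrightarrow> v i \<le> m" for m :: nat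
  by (metis atLeastAtMost_iff permutes_in_image permutes_not_in)

lemma permutes_pos: "v permutes {1..m} \<Longrightarrow> 1 \<le> i \<Longrightarrow> 1 \<le> v i" for m :: nat
  by (metis atLeastAtMost_iff permutes_in_image permutes_not_in)

lemma bub_fixes:
  assumes v: "v permutes {1..Suc n}" and "i \<notin> {1..n}"
  shows "bub v i = i"
proof (cases "i = 0")
  case False
  then have i: "Suc n \<le> i" using assms by auto
  have "v (Suc i) = Suc i" using v i by (intro permutes_not_in) auto
  moreover have "Min (v ` {1..i}) \<le> v 1" using False by (intro Min_le) auto
  moreover have "v 1 \<le> Suc n" using permutes_atMost_le[OF v] by simp
  ultimately have "max (Min (v ` {1..i})) (v (Suc i)) = Suc i" using i by linarith
  then show ?thesis using False by (simp add: bub_def)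
qed (simp add: bub_def)

text \<open>The two cases say whether the carried minimum \<open>h\<close> survives the comparison
  with \<open>v (Suc i)\<close> or is dropped at position \<open>i\<close>.\<close>

lemma bub_inv_bub:
  assumes v: "v permutes {1..m}"
  shows "bub (inv v) (bub v i) = i"
proof (cases "i = 0")
  case False
  let ?w = "inv v"
  define h where "h = Min (v ` {1..i})"
  have w: "?w permutes {1..m}" using v by (rule permutes_inv)
  have wv: "?w (v k) = k" and vw: "v (?w k) = k" for k
    using permutes_inverses[OF v] by auto
  have "h \<in> v ` {1..i}" unfolding h_def using False by (intro Min_in) auto
  then obtain j where j: "1 \<le> j" "j \<le> i" "v j = h" by auto
  have h_le: "h \<le> v k" if "1 \<le> k" "k \<le> i" for k unfolding h_def using that by (intro Min_le) auto
  have ne: "v (Suc i) \<noteq> h" using j wv by (metis Suc_n_not_le_n)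
  have h1: "1 \<le> h" using j permutes_pos[OF v, of j] by simp
  show ?thesis
  proof (cases "h < v (Suc i)")
    case True
    let ?y = "v (Suc i)"
    \<comment> \<open>The surviving \<open>h\<close> is a value below \<open>?y\<close> at a
      position at most \<open>i\<close>. So the pass on the inverse carries something at most
      \<open>i\<close> when it meets \<open>?w ?y = Suc i\<close>, and drops the latter.\<close>
    have "Min (?w ` {1..?y - 1}) \<le> ?w h" using True h1 by (intro Min_le) auto
    then have "Min (?w ` {1..?y - 1}) \<le> i" using j wv by (metis order_trans)
    moreover have "bub v i = ?y - 1" using False True by (simp add: bub_def h_def)
    ultimately show ?thesis using True h1 wv[of "Suc i"] by (simp add: bub_def max_def)
  next
    case False': False
    then have less: "v (Suc i) < h" using ne by simp
    have y1: "1 \<le> v (Suc i)" using permutes_pos[OF v] by simp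
    \<comment> \<open>All values below \<open>h\<close> sit after position \<open>i\<close>, and
      \<open>v (Suc i)\<close> is one of them. So the pass on the inverse carries
      \<open>Suc i\<close> up to \<open>h\<close>, where it drops it for the smaller
      \<open>?w h\<close>.\<close>
    have "Min (?w ` {1..h - 1}) = Suc i"
    proof (rule Min_eqI)
      fix y assume "y \<in> ?w ` {1..h - 1}"
      then obtain k where k: "1 \<le> k" "k \<le> h - 1" "y = ?w k" by auto
      then have "k < h" using h1 by linarith
      moreover have "1 \<le> y" "v y = k" using k permutes_pos[OF w] vw by auto
      ultimately show "Suc i \<le> y" using h_le[of y] by (meson not_less_eq_eq leD)
    next
      show "Suc i \<in> ?w ` {1..h - 1}"
        using less y1 wv[of "Suc i"] by (intro image_eqI[of _ _ "v (Suc i)"]) auto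
    qed simp
    moreover have "?w h \<le> i" using j wv by metis
    moreover have "bub v i = h - 1" using False less by (simp add: bub_def h_def)
    ultimately show ?thesis using less y1 by (simp add: bub_def)
  qed
qed (simp add: bub_def)

lemma bub_comp_bub_inv:
  assumes "v permutes {1..m}"
  shows "bub v (bub (inv v) i) = i"
  using bub_inv_bub[OF permutes_inv[OF assms]] permutes_inv_inv[OF assms] by simp

lemma inv_bub: "v permutes {1..m} \<Longrightarrow> inv (bub v) = bub (inv v)"
  by (intro inv_unique_comp) (auto simp: bub_inv_bub bub_comp_bub_inv)

lemma bub_permutes:
  assumes "v permutes {1..Suc n}"
  shows "bub v permutes {1..n}"
  unfolding permutes_def
proof (intro conjI allI impI)
  show "bub v i = i" if "i \<notin> {1..n}" for i
    using assms that by (rule bub_fixes)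
  show "\<exists>!i. bub v i = j" for j
    using bub_inv_bub[OF assms] bub_comp_bub_inv[OF assms]
    by (intro ex1I[of _ "bub (inv v) j"]) auto
qed

section \<open>Length, descents and \<open>Del\<close> under the pass\<close>

lemma inv_list_swap:
  "a < b \<Longrightarrow> inv_list (xs @ b # a # ys) = Suc (inv_list (xs @ a # b # ys))"
  by (induction xs) auto

lemma ell_S_comp_gen_s:
  assumes "1 \<le> i" "i < n" "p i < p (Suc i)"
  shows "ell_S n (p \<circ> gen_s i) = Suc (ell_S n p)"
proof -
  have "[1..<Suc n] = [1..<i] @ [i..<Suc n]"
    using assms upt_add_eq_append[of 1 i "Suc n - i"] by simp
  also have "[i..<Suc n] = i # Suc i # [Suc (Suc i)..<Suc n]"
    using assms by (simp add: upt_conv_Cons)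
  finally have upt: "[1..<Suc n] = [1..<i] @ i # Suc i # [Suc (Suc i)..<Suc n]" .
  have "map (p \<circ> gen_s i) [1..<i] = map p [1..<i]"
    "map (p \<circ> gen_s i) [Suc (Suc i)..<Suc n] = map p [Suc (Suc i)..<Suc n]"
    by (auto simp: gen_s_apply)
  then have "one_line n (p \<circ> gen_s i) =
      map p [1..<i] @ p (Suc i) # p i # map p [Suc (Suc i)..<Suc n]"
    unfolding one_line_def upt by (simp add: gen_s_apply)
  moreover have "one_line n p = map p [1..<i] @ p i # p (Suc i) # map p [Suc (Suc i)..<Suc n]"
    unfolding one_line_def upt by simp
  ultimately show ?thesis using inv_list_swap[OF assms(3)] by (simp only: ell_S_one_line)
qed

lemma ell_S_Suc:
  assumes "p permutes {1..n}"
  shows "ell_S (Suc n) p = ell_S n p"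
proof -
  have "\<not> p (Suc n) < p i" if "i \<le> n" for i
    using permutes_atMost_le[OF assms that] permutes_not_in[OF assms, of "Suc n"] by simp
  then have "{(i, j). 1 \<le> i \<and> i < j \<and> j \<le> Suc n \<and> p j < p i} =
      {(i, j). 1 \<le> i \<and> i < j \<and> j \<le> n \<and> p j < p i}"
    by (auto simp: le_Suc_eq)
  then show ?thesis by (simp only: ell_S_def)
qed

lemma comp_gen_a: "v \<circ> gen_a i = v \<circ> gen_s 1 \<circ> gen_s (Suc i)"
  by (simp add: gen_a_def comp_assoc)

text \<open>In a_i = s_1 s_(i+1) the factor s_1 is invisible to \<open>bub\<close>, and s_(i+1) acts
  as s_i, changing the length by one, or leaves \<open>bub v\<close> fixed. In the latter case the
  lengths agree, which the weak inequality admits, and \<open>bub v\<close> does have a descent at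
  \<open>i\<close>.\<close>

lemma ell_S_bub_gen_a_le_iff:
  assumes v: "v permutes {1..Suc n}" and i: "1 \<le> i" "i < n"
  shows "ell_S n (bub (v \<circ> gen_a i)) \<le> ell_S n (bub v) \<longleftrightarrow> bub v (Suc i) < bub v i"
proof -
  define u where "u = v \<circ> gen_s 1"
  have u: "u permutes {1..Suc n}"
    unfolding u_def using v i by (intro permutes_compose gen_s_permutes) auto
  have bub_u: "bub u = bub v" by (simp only: u_def bub_comp_gen_s_1)
  have gen_a: "v \<circ> gen_a i = u \<circ> gen_s (Suc i)" by (simp only: u_def comp_gen_a)
  let ?h = "Min (u ` {1..i})"
  show ?thesis
  proof (cases "u (Suc i) < ?h \<and> u (Suc (Suc i)) < ?h")
    case True
    have "bub u i = ?h - 1" using True i by (simp add: bub_def)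
    moreover have "bub u (Suc i) = max (u (Suc i)) (u (Suc (Suc i))) - 1"
      using True prefix_Min_Suc[OF i(1), of u] unfolding bub_def by simp
    \<comment> \<open>Entries are positive, so lowering by 1 keeps the inequality between the
      entries strict.\<close>
    moreover have "1 \<le> u (Suc i)" using permutes_pos[OF u] by simp
    ultimately have "bub u (Suc i) < bub u i" using True by linarith
    moreover have "bub (v \<circ> gen_a i) = bub v"
      using True bub_comp_gen_s[OF i(1), of u] by (simp add: gen_a bub_u)
    ultimately show ?thesis by (simp add: bub_u)
  next
    case False
    then have eq: "bub (v \<circ> gen_a i) = bub v \<circ> gen_s i"
      using bub_comp_gen_s[OF i(1), of u] by (simp only: gen_a bub_u if_False)
    have "bub v i \<noteq> bub v (Suc i)"
      by (simp add: inj_eq[OF permutes_inj[OF bub_permutes[OF v]]])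
    then consider "bub v i < bub v (Suc i)" | "bub v (Suc i) < bub v i" by linarith
    then show ?thesis
    proof cases
      case 1
      then show ?thesis using ell_S_comp_gen_s[OF i, of "bub v"] eq by simp
    next
      case 2
      then have "(bub v \<circ> gen_s i) i < (bub v \<circ> gen_s i) (Suc i)" by (simp add: gen_s_apply)
      then have "ell_S n (bub v \<circ> gen_s i \<circ> gen_s i) = Suc (ell_S n (bub v \<circ> gen_s i))"
        by (rule ell_S_comp_gen_s[OF i])
      then show ?thesis using 2 eq by (simp add: comp_assoc)
    qed
  qed
qed

text \<open>Once \<open>k\<close> entries have been read, the pass has put down all of them except
  the carried minimum; \<open>Suc\<close> undoes the lowering.\<close>

lemma bub_image_prefix:
  assumes v: "v permutes {1..Suc n}" and "1 \<le> k"
  shows "(\<lambda>j. Suc (bub v j)) ` {1..<k} = v ` {1..k} - {Min (v ` {1..k})}"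
  using \<open>1 \<le> k\<close>
proof (induction k rule: dec_induct)
  case base
  then show ?case by simp
next
  case (step k)
  define V h b where "V = v ` {1..k}" and "h = Min V" and "b = v (Suc k)"
  have "h \<in> V" unfolding h_def V_def using step by (intro Min_in) auto
  have "b \<notin> V" unfolding b_def V_def by (auto simp: inj_eq[OF permutes_inj[OF v]])
  have V': "v ` {1..Suc k} = insert b V" and Min: "Min (v ` {1..Suc k}) = min h b"
    using step prefix_Min_Suc[of k v] by (auto simp: V_def b_def h_def atLeastAtMostSuc_conv)
  have "1 \<le> b" unfolding b_def using permutes_pos[OF v] by simp
  then have "Suc (bub v k) = max h b" using step by (simp add: bub_def h_def V_def b_def)
  moreover have "{1..<Suc k} = insert k {1..<k}" using step by auto
  moreover have "(\<lambda>j. Suc (bub v j)) ` {1..<k} = V - {h}" using step by (simp add: V_def h_def)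
  ultimately have "(\<lambda>j. Suc (bub v j)) ` {1..<Suc k} = insert (max h b) (V - {h})" by simp
  also have "\<dots> = insert b V - {min h b}"
    using \<open>h \<in> V\<close> \<open>b \<notin> V\<close> by (cases "h \<le> b") auto
  finally show ?case unfolding Min unfolding V' .
qed

text \<open>At most one of the first \<open>k\<close> entries is below the next entry
  \<open>b\<close> iff none is apart from their minimum \<open>h\<close>. This means that
  \<open>max h b\<close>, the entry put down, is smaller than all entries put down before.\<close>

lemma Del_A_bub:
  assumes v: "v permutes {1..Suc n}"
  shows "Del_A n v = Suc ` Del_S n (bub v)"
proof -
  have "card {j \<in> {1..<Suc k}. v j < v (Suc k)} \<le> 1 \<longleftrightarrow> (\<forall>j\<in>{1..<k}. bub v k < bub v j)"
    if k: "1 < k" for k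
  proof -
    define V h b where "V = v ` {1..k}" and "h = Min V" and "b = v (Suc k)"
    have "h \<in> V" unfolding h_def V_def using k by (intro Min_in) auto
    have min: "h \<le> y" if "y \<in> V" for y
      unfolding h_def using that by (intro Min_le) (auto simp: V_def)
    have "b \<notin> V" unfolding b_def V_def by (auto simp: inj_eq[OF permutes_inj[OF v]])
    have "finite V" by (simp add: V_def)
    have "1 \<le> b" unfolding b_def using permutes_pos[OF v] by simp
    then have bub: "Suc (bub v k) = max h b" using k by (simp add: bub_def h_def V_def b_def)
    have "(\<forall>j\<in>{1..<k}. bub v k < bub v j) \<longleftrightarrow> (\<forall>y\<in>(\<lambda>j. Suc (bub v j)) ` {1..<k}. max h b < y)"
      by (simp flip: bub)
    also have "\<dots> \<longleftrightarrow> (\<forall>y\<in>V - {h}. max h b < y)"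
      using bub_image_prefix[OF v, of k] k by (simp add: V_def h_def)
    also have "\<dots> \<longleftrightarrow> {y \<in> V. y < b} \<subseteq> {h}"
    proof -
      have "max h b < y \<longleftrightarrow> \<not> y < b" if "y \<in> V - {h}" for y
        using that min[of y] \<open>b \<notin> V\<close> by (cases "y = b") auto
      then show ?thesis by auto
    qed
    also have "\<dots> \<longleftrightarrow> card {y \<in> V. y < b} \<le> 1"
    proof
      assume "{y \<in> V. y < b} \<subseteq> {h}"
      then show "card {y \<in> V. y < b} \<le> 1" using card_mono[of "{h}"] by simp
    next
      \<comment> \<open>If \<open>y\<close> is below \<open>b\<close>, then so is the minimum
        \<open>h\<close>; having only one such entry forces \<open>y = h\<close>.\<close>
      assume card: "card {y \<in> V. y < b} \<le> 1"
      have "y = h" if "y \<in> V" "y < b" for y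
      proof -
        have "h < b" using min[OF that(1)] that(2) by simp
        then have "{h, y} \<subseteq> {y \<in> V. y < b}" using \<open>h \<in> V\<close> that by auto
        then have "card {h, y} \<le> 1" using card card_mono[of "{y \<in> V. y < b}" "{h, y}"] \<open>finite V\<close>
          by simp
        then show ?thesis by (cases "y = h") auto
      qed
      then show "{y \<in> V. y < b} \<subseteq> {h}" by auto
    qed
    also have "{y \<in> V. y < b} = v ` {j \<in> {1..<Suc k}. v j < b}"
      by (auto simp: V_def less_Suc_eq_le)
    also have "card \<dots> = card {j \<in> {1..<Suc k}. v j < b}"
      using permutes_inj[OF v] by (intro card_image) (auto intro: inj_on_subset)
    finally show ?thesis by (simp add: b_def)
  qed
  note iff = this
  show ?thesis
  proof (intro set_eqI iffI)
    fix i assume "i \<in> Del_A n v"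
    then have i: "3 \<le> i" "i \<le> Suc n" "card {j \<in> {1..<i}. v j < v i} \<le> 1"
      by (auto simp: Del_A_def)
    then obtain k where k: "i = Suc k" by (cases i) auto
    then have "k \<in> Del_S n (bub v)" using i iff[of k] by (auto simp: Del_S_def)
    then show "i \<in> Suc ` Del_S n (bub v)" by (simp add: k)
  next
    fix i assume "i \<in> Suc ` Del_S n (bub v)"
    then obtain k where k: "i = Suc k" "1 < k" "k \<le> n" "\<forall>j\<in>{1..<k}. bub v k < bub v j"
      by (auto simp: Del_S_def)
    then have "card {j \<in> {1..<Suc k}. v j < v (Suc k)} \<le> 1" using iff[of k] by blast
    then show "i \<in> Del_A n v" using k(1-3) by (simp add: Del_A_def)
  qed
qed

subsection \<open>Canonical presentations in the alternating group\<close>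

lemma permutes_imp_permutation: "p permutes {1..m} \<Longrightarrow> permutation p" for m :: nat
  by (auto simp: permutation_permutes)

lemma id_in_alt_perms: "id \<in> alt_perms m"
  by (simp add: alt_perms_def)

lemma comp_in_alt_perms: "\<lbrakk>p \<in> alt_perms m; q \<in> alt_perms m\<rbrakk> \<Longrightarrow> p \<circ> q \<in> alt_perms m"
  by (auto simp: alt_perms_def evenperm_comp permutes_imp_permutation intro: permutes_compose)

lemma inv_in_alt_perms: "p \<in> alt_perms m \<Longrightarrow> inv p \<in> alt_perms m"
  by (auto simp: alt_perms_def evenperm_inv permutes_imp_permutation intro: permutes_inv)

lemma not_evenperm_gen_s: "\<not> evenperm (gen_s i)"
  by (simp add: gen_s_def evenperm_swap)

lemma permutation_gen_s: "permutation (gen_s i)"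
  by (simp add: gen_s_def permutation_swap_id)

lemma gen_a_in_alt_perms:
  assumes "1 \<le> i" "Suc (Suc i) \<le> m"
  shows "gen_a i \<in> alt_perms m"
proof -
  have "gen_a i permutes {1..m}"
    unfolding gen_a_def using assms by (intro permutes_compose gen_s_permutes) auto
  moreover have "evenperm (gen_a i)"
    by (simp add: gen_a_def evenperm_comp permutation_gen_s not_evenperm_gen_s)
  ultimately show ?thesis by (simp add: alt_perms_def)
qed

lemma word_perm_append: "word_perm (xs @ ys) = word_perm xs \<circ> word_perm ys"
  by (induction xs) (auto simp: word_perm_def comp_assoc)

lemma word_perm_Nil: "word_perm [] = id"
  by (simp add: word_perm_def)

lemma word_perm_single: "word_perm [x] = letter_perm x"
  by (simp add: word_perm_def)

lemma word_perm_in_alt_perms: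
  assumes "\<And>x. x \<in> set w \<Longrightarrow> 1 \<le> fst x \<and> Suc (Suc (fst x)) \<le> m"
  shows "word_perm w \<in> alt_perms m"
  using assms
proof (induction w)
  case Nil
  show ?case by (simp only: word_perm_Nil id_in_alt_perms)
next
  case (Cons x w)
  have eq: "word_perm (x # w) = letter_perm x \<circ> word_perm w" by (simp add: word_perm_def)
  have "letter_perm x \<in> alt_perms m"
    using Cons.prems[of x] gen_a_in_alt_perms[of "fst x" m] inv_in_alt_perms
    by (auto simp: letter_perm_def)
  then show ?case unfolding eq using Cons by (intro comp_in_alt_perms) auto
qed

lemma desc_word_empty [simp]: "desc_word j (Suc j) = []"
  by (simp add: desc_word_def)

lemma desc_word_snoc: "k \<le> j \<Longrightarrow> desc_word j k = desc_word j (Suc k) @ [(k, True)]"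
  by (simp add: desc_word_def upt_conv_Cons)

lemma R_A_cases:
  assumes "r \<in> R_A j"
  obtains (desc) k where "1 \<le> k" "k \<le> Suc j" "r = desc_word j k"
  | (inverse) "r = desc_word j 2 @ [(1, False)]"
  using assms by (auto simp: R_A_def)

lemma word_perm_R_A: "\<lbrakk>1 \<le> j; r \<in> R_A j\<rbrakk> \<Longrightarrow> word_perm r \<in> alt_perms (Suc (Suc j))"
  by (intro word_perm_in_alt_perms) (auto simp: R_A_def desc_word_def)

lemma inv_gen_a_1: "inv (gen_a 1) = gen_s 2 \<circ> gen_s 1"
proof (rule inv_unique_comp)
  have "gen_s 1 \<circ> gen_s 2 \<circ> (gen_s 2 \<circ> gen_s 1) = gen_s 1 \<circ> (gen_s 2 \<circ> gen_s 2) \<circ> gen_s 1"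
    by (simp only: comp_assoc)
  then show "gen_a 1 \<circ> (gen_s 2 \<circ> gen_s 1) = id"
    unfolding gen_a_def one_add_one by (simp only: gen_s_comp comp_id)
  have "gen_s 2 \<circ> gen_s 1 \<circ> (gen_s 1 \<circ> gen_s 2) = gen_s 2 \<circ> (gen_s 1 \<circ> gen_s 1) \<circ> gen_s 2"
    by (simp only: comp_assoc)
  then show "gen_s 2 \<circ> gen_s 1 \<circ> gen_a 1 = id"
    unfolding gen_a_def one_add_one by (simp only: gen_s_comp comp_id)
qed

text \<open>The rightmost letter a_k acts first and raises k + 1 to k + 2; the others raise it
  further, one by one, to j + 2. Over all \<open>k\<close> these preimages of j + 2 run through 2,
  ..., j + 2, and the word ending in the inverse letter supplies the preimage 1.\<close>

lemma word_perm_desc_word_apply: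
  assumes "k \<le> Suc j" "1 \<le> k"
  shows "word_perm (desc_word j k) (Suc k) = Suc (Suc j)"
  using assms
proof (induction k rule: inc_induct)
  case base
  then show ?case by (simp add: word_perm_Nil)
next
  case (step k)
  have "gen_a k (Suc k) = Suc (Suc k)" using step.prems by (simp add: gen_a_def gen_s_apply)
  then show ?case using step
    by (simp add: desc_word_snoc word_perm_append word_perm_single letter_perm_def)
qed

lemma word_perm_desc_word_inverse_apply:
  assumes "1 \<le> j"
  shows "word_perm (desc_word j 2 @ [(1, False)]) 1 = Suc (Suc j)"
proof -
  have "inv (gen_a 1) 1 = Suc 2" by (simp only: inv_gen_a_1) (simp add: gen_s_apply)
  then show ?thesis using word_perm_desc_word_apply[of 2 j] assms
    by (simp add: word_perm_append word_perm_single letter_perm_def)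
qed

text \<open>Together with \<open>R_A_unique\<close>, this makes the elements of \<open>R_A j\<close>
  representatives of the cosets of the stabiliser of j + 2, indexed by the preimage of j +
  2.\<close>

lemma R_A_ex:
  assumes "1 \<le> j" "1 \<le> i" "i \<le> Suc (Suc j)"
  shows "\<exists>r\<in>R_A j. word_perm r i = Suc (Suc j)"
proof (cases "i = 1")
  case True
  then show ?thesis using word_perm_desc_word_inverse_apply[OF assms(1)]
    by (intro bexI[of _ "desc_word j 2 @ [(1, False)]"]) (auto simp: R_A_def)
next
  case False
  then show ?thesis using assms word_perm_desc_word_apply[of "i - 1" j]
    by (intro bexI[of _ "desc_word j (i - 1)"]) (auto simp: R_A_def)
qed

lemma R_A_unique:
  assumes j: "1 \<le> j" and r: "r \<in> R_A j" "r' \<in> R_A j"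
    and eq: "word_perm r i = Suc (Suc j)" "word_perm r' i = Suc (Suc j)"
  shows "r = r'"
proof -
  have pos: "s = (if i = 1 then desc_word j 2 @ [(1, False)] else desc_word j (i - 1))"
    if s: "s \<in> R_A j" "word_perm s i = Suc (Suc j)" for s
  proof -
    have inj: "inj (word_perm s)"
      using word_perm_R_A[OF j s(1)] permutes_inj by (auto simp: alt_perms_def)
    from s(1) show ?thesis
    proof (cases rule: R_A_cases)
      case (desc k)
      have "i = Suc k" using desc word_perm_desc_word_apply[of k j] s(2) injD[OF inj, of i "Suc k"]
        by simp
      then show ?thesis using desc by simp
    next
      case inverse
      have "i = 1" using inverse word_perm_desc_word_inverse_apply[OF j] s(2) injD[OF inj, of i 1]
        by simp
      then show ?thesis using inverse by simp
    qed
  qed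
  show ?thesis using pos[OF r(1) eq(1)] pos[OF r(2) eq(2)] by simp
qed

text \<open>The largest entry is never below the carried minimum, so the swap passes through
  \<open>bub\<close>. There it moves the largest entry of \<open>bub v\<close> one place to the
  left, creating one inversion.\<close>

lemma ell_S_bub_move_max:
  assumes v: "v permutes {1..Suc (Suc n)}" and k: "1 \<le> k" "k \<le> n"
    and max: "v (Suc (Suc k)) = Suc (Suc n)"
  shows "ell_S (Suc n) (bub (v \<circ> gen_s (Suc k))) = Suc (ell_S (Suc n) (bub v))"
proof -
  have b: "bub v permutes {1..Suc n}" using v by (rule bub_permutes)
  have "Min (v ` {1..k}) \<le> v 1" using k by (intro Min_le) auto
  also have "v 1 \<le> v (Suc (Suc k))" using permutes_atMost_le[OF v, of 1] max by simp
  finally have "\<not> v (Suc (Suc k)) < Min (v ` {1..k})" by (rule leD)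
  then have eq: "bub (v \<circ> gen_s (Suc k)) = bub v \<circ> gen_s k"
    using bub_comp_gen_s[OF k(1), of v] by (simp only: if_False simp_thms)
  have "Suc n \<le> bub v (Suc k)" using max by (simp add: bub_def)
  moreover have "bub v k \<le> Suc n" using permutes_atMost_le[OF b, of k] k by simp
  moreover have "bub v k \<noteq> bub v (Suc k)" by (simp add: inj_eq[OF permutes_inj[OF b]])
  ultimately have "bub v k < bub v (Suc k)" by linarith
  then show ?thesis unfolding eq using k by (intro ell_S_comp_gen_s) auto
qed

text \<open>Each further letter moves the largest entry one place to the left, after an s_1 that
  \<open>bub\<close> does not see.\<close>

lemma ell_S_bub_desc_word:
  assumes u: "u permutes {1..Suc n}" and "k \<le> Suc n" "1 \<le> k"
  shows "ell_S (Suc n) (bub (u \<circ> word_perm (desc_word n k))) =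
    ell_S n (bub u) + length (desc_word n k)"
  using assms(2,3)
proof (induction k rule: inc_induct)
  case base
  \<comment> \<open>Here \<open>bub u\<close> fixes \<open>Suc n\<close>, so the larger size adds no
    inversion.\<close>
  show ?case
    unfolding desc_word_empty word_perm_Nil comp_id ell_S_Suc[OF bub_permutes[OF u]] by simp
next
  case (step k)
  define v where "v = u \<circ> word_perm (desc_word n (Suc k))"
  have "word_perm (desc_word n (Suc k)) \<in> alt_perms (Suc (Suc n))"
    using step by (intro word_perm_R_A) (auto simp: R_A_def)
  then have v: "v permutes {1..Suc (Suc n)}"
    unfolding v_def alt_perms_def using permutes_subset[OF u]
    by (auto intro!: permutes_compose)
  have "word_perm (desc_word n (Suc k)) (Suc (Suc k)) = Suc (Suc n)"
    using step by (intro word_perm_desc_word_apply) auto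
  then have max: "v (Suc (Suc k)) = Suc (Suc n)"
    using permutes_not_in[OF u, of "Suc (Suc n)"] by (simp add: v_def)
  have "u \<circ> word_perm (desc_word n k) = v \<circ> gen_a k"
    using step
    by (simp add: desc_word_snoc word_perm_append word_perm_single letter_perm_def v_def comp_assoc)
  then have eq: "u \<circ> word_perm (desc_word n k) = v \<circ> gen_s 1 \<circ> gen_s (Suc k)"
    by (simp only: comp_gen_a)
  have move: "ell_S (Suc n) (bub (v \<circ> gen_s 1 \<circ> gen_s (Suc k))) =
      Suc (ell_S (Suc n) (bub (v \<circ> gen_s 1)))"
  proof (rule ell_S_bub_move_max)
    show "v \<circ> gen_s 1 permutes {1..Suc (Suc n)}"
      using v step by (intro permutes_compose gen_s_permutes) auto
    show "(v \<circ> gen_s 1) (Suc (Suc k)) = Suc (Suc n)" using max step by (simp add: gen_s_apply)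
  qed (use step in auto)
  have IH: "ell_S (Suc n) (bub v) = ell_S n (bub u) + length (desc_word n (Suc k))"
    unfolding v_def by (rule step.IH) simp
  have "length (desc_word n k) = Suc (length (desc_word n (Suc k)))"
    using step by (simp add: desc_word_snoc[of k n])
  then show ?case unfolding eq move bub_comp_gen_s_1 IH by simp
qed

lemma ell_S_bub_R_A:
  assumes u: "u permutes {1..Suc n}" and n: "1 \<le> n" and r: "r \<in> R_A n"
  shows "ell_S (Suc n) (bub (u \<circ> word_perm r)) = ell_S n (bub u) + length r"
  using r
proof (cases rule: R_A_cases)
  case (desc k)
  then show ?thesis using ell_S_bub_desc_word[OF u] by simp
next
  case inverse
  define v where "v = u \<circ> word_perm (desc_word n 2)"
  have "word_perm (desc_word n 2) \<in> alt_perms (Suc (Suc n))"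
    using n by (intro word_perm_R_A) (auto simp: R_A_def)
  then have v: "v permutes {1..Suc (Suc n)}"
    unfolding v_def alt_perms_def using permutes_subset[OF u]
    by (auto intro!: permutes_compose)
  have "word_perm (desc_word n 2) (Suc 2) = Suc (Suc n)"
    using n by (intro word_perm_desc_word_apply) auto
  then have max: "v (Suc (Suc 1)) = Suc (Suc n)"
    using permutes_not_in[OF u, of "Suc (Suc n)"] by (simp add: v_def numeral_2_eq_2)
  \<comment> \<open>Since a_1 inverse is s_2 s_1, the largest entry goes from position 3 to 2, which
    costs one inversion, and then to 1, which \<open>bub\<close> does not see.\<close>
  have "u \<circ> word_perm r = v \<circ> gen_s (Suc 1) \<circ> gen_s 1"
    using inv_gen_a_1
    by (simp add: inverse word_perm_append word_perm_single letter_perm_def v_def comp_assoc numeral_2_eq_2)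
  then have "ell_S (Suc n) (bub (u \<circ> word_perm r)) = ell_S (Suc n) (bub (v \<circ> gen_s (Suc 1)))"
    by (simp only: bub_comp_gen_s_1)
  also have "\<dots> = Suc (ell_S (Suc n) (bub v))"
    using v n max by (intro ell_S_bub_move_max) auto
  also have "ell_S (Suc n) (bub v) = ell_S n (bub u) + length (desc_word n 2)"
    unfolding v_def using n by (intro ell_S_bub_desc_word[OF u]) auto
  finally have "ell_S (Suc n) (bub (u \<circ> word_perm r)) =
      Suc (ell_S n (bub u) + length (desc_word n 2))" .
  moreover have "length r = Suc (length (desc_word n 2))" by (simp add: inverse)
  ultimately show ?thesis by (simp only: add_Suc_right)
qed

section \<open>Existence, uniqueness and length of the canonical presentation\<close>

lemma A_presentation_snoc:
  assumes "1 \<le> n"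
  shows "A_presentation (Suc n) v ws \<longleftrightarrow>
    (\<exists>us r. ws = us @ [r] \<and> r \<in> R_A n \<and> A_presentation n (word_perm (concat us)) us \<and>
       v = word_perm (concat us) \<circ> word_perm r)"
proof
  assume A: "A_presentation (Suc n) v ws"
  then have "length ws = Suc (n - 1)" using assms by (simp add: A_presentation_def)
  then obtain us r where ws: "ws = us @ [r]" "length us = n - 1"
    by (metis length_Suc_conv_rev)
  have R: "ws ! j \<in> R_A (Suc j)" if "j < n" for j using A that by (simp add: A_presentation_def)
  \<comment> \<open>The last of the \<open>n\<close> factors has list index \<open>n - 1\<close>,
    hence lies in \<open>R_A n\<close>.\<close>
  have "r \<in> R_A n" using R[of "n - 1"] ws assms by (simp add: nth_append)
  moreover have "us ! j \<in> R_A (Suc j)" if "j < n - 1" for j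
    using R[of j] ws that by (simp add: nth_append)
  ultimately show "\<exists>us r. ws = us @ [r] \<and> r \<in> R_A n \<and> A_presentation n (word_perm (concat us)) us \<and>
       v = word_perm (concat us) \<circ> word_perm r"
    using A ws by (auto simp: A_presentation_def word_perm_append)
next
  assume "\<exists>us r. ws = us @ [r] \<and> r \<in> R_A n \<and> A_presentation n (word_perm (concat us)) us \<and>
       v = word_perm (concat us) \<circ> word_perm r"
  then obtain us r where us: "ws = us @ [r]" "r \<in> R_A n" "A_presentation n (word_perm (concat us)) us"
    "v = word_perm (concat us) \<circ> word_perm r" by blast
  then have len: "length us = n - 1" by (simp add: A_presentation_def)
  have "ws ! j \<in> R_A (Suc j)" if "j < n" for j
  proof (cases "j < n - 1")
    case True
    then show ?thesis using us len by (simp add: A_presentation_def nth_append)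
  next
    case False
    then have "j = n - 1" using that by simp
    then show ?thesis using us(1,2) len assms by (simp add: nth_append)
  qed
  then show "A_presentation (Suc n) v ws"
    unfolding A_presentation_def us(4) using us(1) len assms by (simp add: word_perm_append)
qed

lemma A_presentation_in_alt_perms:
  assumes "A_presentation n v ws"
  shows "v \<in> alt_perms (Suc n)"
proof -
  have "1 \<le> fst x \<and> Suc (Suc (fst x)) \<le> Suc n" if x: "x \<in> set (concat ws)" for x
  proof -
    obtain w where "w \<in> set ws" "x \<in> set w" using x by auto
    then obtain j where j: "j < n - 1" "x \<in> set (ws ! j)" "ws ! j \<in> R_A (Suc j)"
      using assms by (auto simp: A_presentation_def in_set_conv_nth[of w])
    have "Suc (Suc j) \<le> n" using j(1) by simp
    then show ?thesis using j(2,3) by (auto simp: R_A_def desc_word_def)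
  qed
  then show ?thesis using word_perm_in_alt_perms[of "concat ws" "Suc n"] assms
    by (simp add: A_presentation_def)
qed

lemma alt_perms_2: "alt_perms 2 = {id}"
proof
  show "alt_perms 2 \<subseteq> {id}"
  proof
    fix v assume v: "v \<in> alt_perms 2"
    have "{1..2::nat} = {1, 2}" by auto
    then have "v permutes {1, 2}" "evenperm v" using v by (auto simp: alt_perms_def)
    then show "v \<in> {id}" using not_evenperm_gen_s[of 1]
      by (auto simp: permutes_doubleton_iff gen_s_def numeral_2_eq_2)
  qed
qed (simp add: id_in_alt_perms)

text \<open>Choose the last factor \<open>r\<close> sending the position of the largest entry of
  \<open>v\<close> to the last position. Then \<open>v \<circ> inv (word_perm r)\<close> fixes the
  largest point and induction applies.\<close>

lemma A_presentation_exists: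
  assumes "1 \<le> n" "v \<in> alt_perms (Suc n)"
  shows "\<exists>ws. A_presentation n v ws"
  using assms
proof (induction n arbitrary: v rule: dec_induct)
  case base
  then have "v = id" using alt_perms_2 by (simp add: numeral_2_eq_2)
  moreover have "A_presentation 1 id []" by (simp add: A_presentation_def word_perm_def)
  ultimately show ?case by blast
next
  case (step n)
  have v: "v permutes {1..Suc (Suc n)}" using step by (simp add: alt_perms_def)
  define i where "i = inv v (Suc (Suc n))"
  have "i \<in> {1..Suc (Suc n)}" unfolding i_def
    using permutes_in_image[OF permutes_inv[OF v], of "Suc (Suc n)"] by simp
  then obtain r where r: "r \<in> R_A n" "word_perm r i = Suc (Suc n)"
    using R_A_ex[of n i] step by auto
  have wr: "word_perm r \<in> alt_perms (Suc (Suc n))" using word_perm_R_A step r by simp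
  then have pr: "word_perm r permutes {1..Suc (Suc n)}" by (simp add: alt_perms_def)
  define u where "u = v \<circ> inv (word_perm r)"
  have u: "u \<in> alt_perms (Suc (Suc n))"
    unfolding u_def using step wr by (intro comp_in_alt_perms inv_in_alt_perms) auto
  have "inv (word_perm r) (Suc (Suc n)) = i"
    using r(2) permutes_inverses(2)[OF pr, of i] by simp
  then have "u (Suc (Suc n)) = Suc (Suc n)"
    unfolding u_def i_def using permutes_inverses(1)[OF v] by simp
  moreover have "u permutes {1..Suc (Suc n)}" using u by (simp add: alt_perms_def)
  moreover have "{1..Suc (Suc n)} - {1..Suc n} = {Suc (Suc n)}" by auto
  ultimately have "u permutes {1..Suc n}" by (metis permutes_superset singletonD)
  then have "u \<in> alt_perms (Suc n)" using u by (simp add: alt_perms_def)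
  then obtain us where us: "A_presentation n u us" using step.IH by blast
  moreover have "u \<circ> word_perm r = v"
    unfolding u_def comp_assoc permutes_inv_o(2)[OF pr] by simp
  ultimately have "A_presentation (Suc n) v (us @ [r])"
    using r step by (subst A_presentation_snoc) (auto simp: A_presentation_def)
  then show ?case by blast
qed

text \<open>The product of the other factors fixes the largest point, so the last factor must send
  the position of the largest entry there. This determines it, and it can be cancelled.\<close>

lemma A_presentation_unique:
  assumes "1 \<le> n" "A_presentation n v ws" "A_presentation n v ws'"
  shows "ws = ws'"
  using assms
proof (induction n arbitrary: v ws ws' rule: dec_induct)
  case base
  then show ?case by (simp add: A_presentation_def)
next
  case (step n)
  obtain us r where us: "ws = us @ [r]" "r \<in> R_A n" "A_presentation n (word_perm (concat us)) us"
    "v = word_perm (concat us) \<circ> word_perm r"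
    using step A_presentation_snoc by meson
  obtain us' r' where us': "ws' = us' @ [r']" "r' \<in> R_A n" "A_presentation n (word_perm (concat us')) us'"
    "v = word_perm (concat us') \<circ> word_perm r'"
    using step A_presentation_snoc by meson
  have pos: "word_perm s (inv v (Suc (Suc n))) = Suc (Suc n)"
    if s: "A_presentation n u ts" "v = u \<circ> word_perm s" for u ts s
  proof -
    have v: "v permutes {1..Suc (Suc n)}"
      using A_presentation_in_alt_perms[OF step.prems(1)] by (simp add: alt_perms_def)
    have u: "u permutes {1..Suc n}"
      using A_presentation_in_alt_perms[OF s(1)] by (simp add: alt_perms_def)
    have "u (word_perm s (inv v (Suc (Suc n)))) = v (inv v (Suc (Suc n)))"
      using s(2) by simp
    also have "\<dots> = u (Suc (Suc n))"
      using permutes_inverses(1)[OF v] permutes_not_in[OF u, of "Suc (Suc n)"] by simp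
    finally show ?thesis by (simp only: inj_eq[OF permutes_inj[OF u]])
  qed
  have "r = r'"
    using R_A_unique[OF step.hyps(1) us(2) us'(2)] pos[OF us(3,4)] pos[OF us'(3,4)] by blast
  moreover have "surj (word_perm r)"
    using word_perm_R_A[OF step.hyps(1) us(2)] permutes_surj by (auto simp: alt_perms_def)
  ultimately have "word_perm (concat us) = word_perm (concat us')"
    using us(4) us'(4) by (metis surj_fun_eq comp_apply)
  then show ?case using step.IH us us' \<open>r = r'\<close> by simp
qed

text \<open>By \<open>ell_S_bub_R_A\<close>, appending a factor raises the inversion number of the
  image by exactly its number of letters.\<close>

lemma length_A_presentation:
  assumes "1 \<le> n" "A_presentation n v ws"
  shows "length (concat ws) = ell_S n (bub v)"
  using assms
proof (induction n arbitrary: v ws rule: dec_induct)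
  case base
  have "ell_S 1 p = 0" for p by (simp add: ell_S_one_line one_line_def upt_rec)
  then show ?case using base by (simp add: A_presentation_def)
next
  case (step n)
  obtain us r where us: "ws = us @ [r]" "r \<in> R_A n" "A_presentation n (word_perm (concat us)) us"
    "v = word_perm (concat us) \<circ> word_perm r"
    using step A_presentation_snoc by meson
  have u: "word_perm (concat us) permutes {1..Suc n}"
    using A_presentation_in_alt_perms[OF us(3)] by (simp add: alt_perms_def)
  show ?case
    unfolding us(4) ell_S_bub_R_A[OF u step.hyps(1) us(2)] by (simp add: us(1) step.IH[OF us(3)])
qed

lemma ell_A_eq_ell_S_bub:
  assumes "1 \<le> n" "v \<in> alt_perms (Suc n)"
  shows "ell_A n v = ell_S n (bub v)"
proof -
  obtain ws where ws: "A_presentation n v ws" using A_presentation_exists[OF assms] by blast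
  then have "(THE ws. A_presentation n v ws) = ws"
    using A_presentation_unique[OF assms(1)] by blast
  then show ?thesis using length_A_presentation[OF assms(1) ws] by (simp add: ell_A_def)
qed

lemma Des_A_eq_Des_S_bub:
  assumes n: "1 \<le> n" and v: "v \<in> alt_perms (Suc n)"
  shows "Des_A n v = Des_S n (bub v)"
proof -
  have "ell_A n (v \<circ> gen_a i) \<le> ell_A n v \<longleftrightarrow> bub v (Suc i) < bub v i" if "i \<in> {1..n - 1}" for i
  proof -
    have "v \<circ> gen_a i \<in> alt_perms (Suc n)"
      using v that by (intro comp_in_alt_perms gen_a_in_alt_perms) auto
    then show ?thesis
      using ell_S_bub_gen_a_le_iff[of v n i] n v that by (auto simp: ell_A_eq_ell_S_bub alt_perms_def)
  qed
  then show ?thesis by (auto simp: Des_A_def Des_S_def)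
qed

subsection \<open>Fibres of the covering map\<close>

text \<open>This is the pass behind \<open>bub\<close> on words, with the final minimum kept and
  nothing lowered. On words, preimages can be counted letter by letter.\<close>

fun bubble :: "nat list \<Rightarrow> nat list" where
  "bubble [] = []"
| "bubble [h] = [h]"
| "bubble (h # b # w) = max h b # bubble (min h b # w)"

lemma mset_bubble: "mset (bubble w) = mset w"
  by (induction w rule: bubble.induct) (auto simp: max_def min_def add_mset_commute)

lemma length_bubble: "length (bubble w) = length w"
  by (metis mset_bubble size_mset)

lemma set_bubble: "set (bubble w) = set w"
  by (metis mset_bubble set_mset_mset)

text \<open>The letter \<open>a\<close> put down first is the larger of the first two. If it came
  second, the head survives and \<open>a\<close> is inserted behind it; if it came first, it is
  itself the head and must obey the bound \<open>x\<close>.\<close>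

lemma bubble_Cons_preimage:
  assumes c: "a \<notin> set c" "c \<noteq> []"
  shows "{w. bubble w = a # c \<and> hd w < x} =
    (\<lambda>w. hd w # a # tl w) ` {w. bubble w = c \<and> hd w < min a x} \<union>
    (if a < x then Cons a ` {w. bubble w = c \<and> hd w < a} else {})"
    (is "?L = ?f ` ?A \<union> ?B")
proof (intro equalityI subsetI)
  fix w assume "w \<in> ?L"
  then have w: "bubble w = a # c" "hd w < x" by auto
  then have "length w = Suc (length c)" using length_bubble[of w] by simp
  then obtain h b v where hbv: "w = h # b # v" using c(2)
    by (cases w rule: bubble.cases) auto
  have a: "max h b = a" and v: "bubble (min h b # v) = c" using w(1) by (simp_all add: hbv)
  \<comment> \<open>The carried letter reappears in \<open>c\<close>, which does not contain
    \<open>a\<close>, so \<open>h\<close> and \<open>b\<close> differ.\<close>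
  have "min h b \<in> set c" using v set_bubble[of "min h b # v"] by auto
  then have "min h b \<noteq> a" using c(1) by auto
  then consider "b = a" "h < a" | "h = a" "b < a" using a by linarith
  then show "w \<in> ?f ` ?A \<union> ?B"
  proof cases
    case 1
    then show ?thesis using v w(2) by (intro UnI1 image_eqI[of _ _ "h # v"]) (simp_all add: hbv min_def)
  next
    case 2
    then show ?thesis using v w(2) by (intro UnI2) (simp add: hbv min_def)
  qed
next
  fix w assume "w \<in> ?f ` ?A \<union> ?B"
  then show "w \<in> ?L"
  proof
    assume "w \<in> ?f ` ?A"
    then obtain u where u: "w = ?f u" "bubble u = c" "hd u < a" "hd u < x" by auto
    then have "u \<noteq> []" using c(2) by auto
    then obtain h v where "u = h # v" by (cases u) auto
    then show ?thesis using u by (simp add: max_def min_def)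
  next
    assume "w \<in> ?B"
    then obtain u where u: "w = a # u" "bubble u = c" "hd u < a" "a < x" by (auto split: if_splits)
    then have "u \<noteq> []" using c(2) by auto
    then obtain h v where "u = h # v" by (cases u) auto
    then show ?thesis using u by (simp add: max_def min_def)
  qed
qed

lemma finite_bubble_preimage: "finite {w. bubble w = c \<and> P w}"
proof (rule finite_subset)
  show "{w. bubble w = c \<and> P w} \<subseteq> {w. set w \<subseteq> set c \<and> length w = length c}"
    using length_bubble set_bubble by auto
  show "finite {w. set w \<subseteq> set c \<and> length w = length c}"
    by (intro finite_lists_length_eq) simp
qed

lemma lr_minima_subset: "lr_minima w \<subseteq> set w"
  by (auto simp: lr_minima_def)

text \<open>The bound \<open>x\<close> on the first letter makes the induction on \<open>c\<close> go through.\<close>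

lemma card_bubble_preimage:
  assumes "distinct c" "\<And>y. y \<in> set c \<Longrightarrow> m < y" "m < x"
  shows "card {w. bubble w = c @ [m] \<and> hd w < x} = 2 ^ card {y \<in> lr_minima c. y < x}"
  using assms
proof (induction c arbitrary: x)
  case Nil
  have "w = [m]" if "bubble w = [m]" for w
  proof -
    have "length w = Suc 0" using that length_bubble[of w] by simp
    then obtain h where "w = [h]" by (auto simp: length_Suc_conv)
    then show ?thesis using that by simp
  qed
  then have "{w. bubble w = [] @ [m] \<and> hd w < x} = {[m]}"
    using Nil.prems(3) by (intro equalityI subsetI) auto
  then show ?case by (simp add: lr_minima_def)
next
  case (Cons a c)
  let ?F = "\<lambda>x. {w. bubble w = c @ [m] \<and> hd w < x}" and ?f = "\<lambda>w. hd w # a # tl w"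
  have IH: "card (?F x) = 2 ^ card {y \<in> lr_minima c. y < x}" if "m < x" for x
    using Cons that by simp
  have m: "m < a" using Cons.prems by simp
  have "a \<notin> set (c @ [m])" using Cons.prems m by auto
  then have eq: "{w. bubble w = (a # c) @ [m] \<and> hd w < x} =
      ?f ` ?F (min a x) \<union> (if a < x then Cons a ` ?F a else {})"
    using bubble_Cons_preimage[of a "c @ [m]" x] by simp
  have ne: "w \<noteq> []" if "w \<in> ?F x" for w x using that by auto
  have inj: "inj_on ?f (?F x)" for x
  proof (rule inj_onI)
    fix v w assume "v \<in> ?F x" "w \<in> ?F x" "?f v = ?f w"
    then show "v = w" using ne[of v x] ne[of w x] by (intro list.expand) simp_all
  qed
  have card_f: "card (?f ` ?F x) = 2 ^ card {y \<in> lr_minima c. y < x}" if "m < x" for x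
    unfolding card_image[OF inj] using that by (rule IH)
  have lr: "lr_minima (a # c) = insert a {y \<in> lr_minima c. y < a}"
    using Cons.prems by (intro lr_minima_Cons) auto
  show ?case
  proof (cases "a < x")
    case True
    then have min: "min a x = a" by simp
    \<comment> \<open>Heads are below \<open>a\<close> in the first family and equal to
      \<open>a\<close> in the second, so the families are disjoint. Having equal size, they give the
      factor 2 for the minimum \<open>a\<close>.\<close>
    have "card {w. bubble w = (a # c) @ [m] \<and> hd w < x} = card (?f ` ?F a) + card (Cons a ` ?F a)"
      unfolding eq min if_P[OF True]
      by (intro card_Un_disjoint finite_imageI finite_bubble_preimage) auto
    also have "\<dots> = 2 * 2 ^ card {y \<in> lr_minima c. y < a}"
      unfolding card_f[OF m] by (simp add: card_image IH[OF m])
    also have "\<dots> = 2 ^ card (insert a {y \<in> lr_minima c. y < a})"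
      using finite_subset[OF lr_minima_subset, of c] by (subst card_insert_disjoint) auto
    also have "insert a {y \<in> lr_minima c. y < a} = {y \<in> lr_minima (a # c). y < x}"
      using True by (auto simp: lr)
    finally show ?thesis .
  next
    case False
    then have min: "min a x = x" by simp
    \<comment> \<open>With \<open>a\<close> not below \<open>x\<close>, a preimage cannot start with
      \<open>a\<close>, and \<open>a\<close> is not counted among the minima below \<open>x\<close>
      either.\<close>
    have "{y \<in> lr_minima c. y < x} = {y \<in> lr_minima (a # c). y < x}"
      using False by (auto simp: lr)
    then show ?thesis
      unfolding eq min if_not_P[OF False] Un_empty_right card_f[OF Cons.prems(3)] by simp
  qed
qed

section \<open>Fibre sizes over permutations\<close>

lemma lr_minima_map_Suc: "distinct w \<Longrightarrow> lr_minima (map Suc w) = Suc ` lr_minima w"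
proof (induction w)
  case Nil
  then show ?case by (simp add: lr_minima_def)
next
  case (Cons x w)
  then have "lr_minima (map Suc (x # w)) = insert (Suc x) {y \<in> Suc ` lr_minima w. y < Suc x}"
    using lr_minima_Cons[of "Suc x" "map Suc w"] by auto
  also have "\<dots> = Suc ` insert x {y \<in> lr_minima w. y < x}" by auto
  also have "insert x {y \<in> lr_minima w. y < x} = lr_minima (x # w)"
    using Cons by (simp add: lr_minima_Cons)
  finally show ?case .
qed

text \<open>The induction runs downwards over intermediate states: the first \<open>k\<close>
  entries have been processed and only their minimum is still carried.\<close>

lemma bubble_upt:
  assumes "k \<le> m" "1 \<le> k"
  shows "bubble (Min (v ` {1..k}) # map v [Suc k..<Suc m]) =
    map (\<lambda>i. max (Min (v ` {1..i})) (v (Suc i))) [k..<m] @ [Min (v ` {1..m})]"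
  using assms
proof (induction k rule: inc_induct)
  case base
  then show ?case by simp
next
  case (step k)
  have "[Suc k..<Suc m] = Suc k # [Suc (Suc k)..<Suc m]" "[k..<m] = k # [Suc k..<m]"
    using step by (simp_all add: upt_conv_Cons)
  then show ?case using step prefix_Min_Suc[of k v] by simp
qed

lemma bubble_one_line:
  assumes v: "v permutes {1..Suc n}"
  shows "bubble (one_line (Suc n) v) = map Suc (one_line n (bub v)) @ [1]"
proof -
  have "one_line (Suc n) v = Min (v ` {1..1}) # map v [Suc 1..<Suc (Suc n)]"
    by (simp add: one_line_def upt_conv_Cons)
  then have "bubble (one_line (Suc n) v) =
      map (\<lambda>i. max (Min (v ` {1..i})) (v (Suc i))) [1..<Suc n] @ [Min (v ` {1..Suc n})]"
    using bubble_upt[of 1 "Suc n" v] by simp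
  moreover have "Min (v ` {1..Suc n}) = 1"
    unfolding permutes_image[OF v] by (intro Min_eqI) auto
  moreover have "max (Min (v ` {1..i})) (v (Suc i)) = Suc (bub v i)" if "1 \<le> i" for i
    using that permutes_pos[OF v, of "Suc i"] by (simp add: bub_def)
  then have "map (\<lambda>i. max (Min (v ` {1..i})) (v (Suc i))) [1..<Suc n] =
      map Suc (one_line n (bub v))"
    by (simp add: one_line_def)
  ultimately show ?thesis by simp
qed

text \<open>One-line notation identifies the fibre with the \<open>bubble\<close> preimages of a
  word ending in 1. The head bound \<open>Suc (Suc n)\<close> exceeds every entry.\<close>

lemma card_bub_fibre:
  assumes n: "1 \<le> n" and p: "p \<in> sym_perms n"
  shows "card {v \<in> sym_perms (Suc n). bub v = p} = 2 ^ Suc (card (Del_S n (inv p)))"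
proof -
  have pp: "p permutes {1..n}" using p by (simp add: sym_perms_def)
  let ?c = "map Suc (one_line n p)"
  let ?W = "{w. bubble w = ?c @ [1] \<and> hd w < Suc (Suc n)}"
  have set: "set (one_line n p) = {1..n}" using pp by (rule set_one_line)
  have dist: "distinct (one_line n p)"
    using bij_betwE[OF bij_betw_one_line] p by (auto simp: permutations_of_set_def)
  have image: "one_line (Suc n) ` {v \<in> sym_perms (Suc n). bub v = p} = ?W"
  proof (intro equalityI subsetI)
    fix w assume "w \<in> one_line (Suc n) ` {v \<in> sym_perms (Suc n). bub v = p}"
    then obtain v where v: "v permutes {1..Suc n}" "bub v = p" "w = one_line (Suc n) v"
      by (auto simp: sym_perms_def)
    have "hd w = v 1" by (simp add: v(3) one_line_def upt_conv_Cons)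
    then show "w \<in> ?W"
      using bubble_one_line[OF v(1)] permutes_atMost_le[OF v(1), of 1] v(2,3) by simp
  next
    fix w assume "w \<in> ?W"
    then have w: "bubble w = ?c @ [1]" by simp
    have "distinct (?c @ [1])" "set (?c @ [1]) = {1..Suc n}"
      using dist set by (auto simp: distinct_map)
    then have "w \<in> permutations_of_set {1..Suc n}"
      using w mset_bubble[of w] set_bubble[of w] mset_eq_imp_distinct_iff[of "bubble w" w]
      by (simp add: permutations_of_set_def)
    then obtain v where v: "v \<in> sym_perms (Suc n)" "w = one_line (Suc n) v"
      using bij_betw_imp_surj_on[OF bij_betw_one_line] by blast
    then have vp: "v permutes {1..Suc n}" by (simp add: sym_perms_def)
    have "one_line n (bub v) = one_line n p"
      using w bubble_one_line[OF vp] v(2) by simp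
    moreover have "bub v \<in> sym_perms n" using bub_permutes[OF vp] by (simp add: sym_perms_def)
    ultimately have "bub v = p"
      using inj_onD[OF bij_betw_imp_inj_on[OF bij_betw_one_line]] p by blast
    then show "w \<in> one_line (Suc n) ` {v \<in> sym_perms (Suc n). bub v = p}" using v by auto
  qed
  have "inj_on (one_line (Suc n)) {v \<in> sym_perms (Suc n). bub v = p}"
    using bij_betw_imp_inj_on[OF bij_betw_one_line] by (rule inj_on_subset) auto
  then have "card {v \<in> sym_perms (Suc n). bub v = p} = card ?W"
    unfolding image[symmetric] by (rule card_image[symmetric])
  also have "\<dots> = 2 ^ card {y \<in> lr_minima ?c. y < Suc (Suc n)}"
    using dist set by (intro card_bubble_preimage) (auto simp: distinct_map)
  also have "{y \<in> lr_minima ?c. y < Suc (Suc n)} = Suc ` lr_minima (one_line n p)"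
    using dist lr_minima_subset[of "one_line n p"] by (auto simp: lr_minima_map_Suc set)
  also have "card \<dots> = card (lr_minima (one_line n p))" by (simp add: card_image)
  \<comment> \<open>The letter 1 is a minimum outside \<open>Del_S\<close>, hence the
    \<open>Suc\<close> in the exponent.\<close>
  also have "lr_minima (one_line n p) = insert 1 (Del_S n (inv p))"
    using n by (auto simp: Del_S_inv_one_line[OF pp] lr_minima_def set)
  also have "card \<dots> = Suc (card (Del_S n (inv p)))"
    by (subst card_insert_disjoint) (auto simp: Del_S_def)
  finally show ?thesis .
qed

section \<open>Summing over the fibres\<close>

lemma finite_sym_perms: "finite (sym_perms m)"
  unfolding sym_perms_def by (rule finite_permutations) simp

text \<open>Swapping the first two entries of \<open>v\<close> changes its parity but not \<open>bub v\<close>.\<close>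

lemma sum_sym_perms_bub:
  fixes G :: "(nat \<Rightarrow> nat) \<Rightarrow> 'a::semiring_1"
  assumes "1 \<le> n"
  shows "(\<Sum>v\<in>sym_perms (Suc n). G (bub v)) = 2 * (\<Sum>v\<in>alt_perms (Suc n). G (bub v))"
proof -
  let ?A = "alt_perms (Suc n)" and ?f = "\<lambda>v. v \<circ> gen_s 1"
  have s: "gen_s 1 permutes {1..Suc n}" using assms by (intro gen_s_permutes) auto
  have ff: "?f (?f v) = v" for v :: "nat \<Rightarrow> nat" by (simp add: comp_assoc)
  have f: "evenperm (?f v) \<longleftrightarrow> \<not> evenperm v" if "v permutes {1..Suc n}" for v
    using that
    by (simp add: evenperm_comp permutes_imp_permutation permutation_gen_s not_evenperm_gen_s)
  have inj: "inj_on ?f ?A" using ff by (metis inj_onI)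
  have "sym_perms (Suc n) = ?A \<union> ?f ` ?A"
  proof (intro equalityI subsetI)
    fix v assume "v \<in> sym_perms (Suc n)"
    then have v: "v permutes {1..Suc n}" by (simp add: sym_perms_def)
    show "v \<in> ?A \<union> ?f ` ?A"
    proof (cases "evenperm v")
      case True
      then show ?thesis using v by (simp add: alt_perms_def)
    next
      case False
      then have "?f v \<in> ?A" using v f[OF v] permutes_compose[OF s v] by (simp add: alt_perms_def)
      then show ?thesis using ff[of v] by (metis UnI2 image_eqI)
    qed
  next
    fix v assume "v \<in> ?A \<union> ?f ` ?A"
    then show "v \<in> sym_perms (Suc n)"
      using permutes_compose[OF s] by (auto simp: alt_perms_def sym_perms_def)
  qed
  moreover have "?A \<inter> ?f ` ?A = {}" using f by (auto simp: alt_perms_def)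
  moreover have "finite ?A"
    by (rule finite_subset[OF _ finite_sym_perms]) (auto simp: alt_perms_def sym_perms_def)
  ultimately have "(\<Sum>v\<in>sym_perms (Suc n). G (bub v)) =
      (\<Sum>v\<in>?A. G (bub v)) + (\<Sum>v\<in>?f ` ?A. G (bub v))"
    by (simp add: sum.union_disjoint)
  also have "(\<Sum>v\<in>?f ` ?A. G (bub v)) = (\<Sum>v\<in>?A. G (bub v))"
    unfolding sum.reindex[OF inj] comp_def[of "\<lambda>v. G (bub v)"] bub_comp_gen_s_1 ..
  finally show ?thesis by (simp add: mult_2)
qed

text \<open>Even permutations contribute half of the sum over all permutations, so the exponent for
  a full fibre drops by one. The doubled sums are compared and the factor 2 is cancelled in
  \<open>int poly\<close>.\<close>

lemma sum_alt_perms_bub: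
  fixes G :: "(nat \<Rightarrow> nat) \<Rightarrow> int poly"
  assumes n: "1 \<le> n"
  shows "(\<Sum>v\<in>alt_perms (Suc n). G (bub v)) =
    (\<Sum>p\<in>sym_perms n. 2 ^ card (Del_S n (inv p)) * G p)"
proof -
  have "2 * (\<Sum>v\<in>alt_perms (Suc n). G (bub v)) = (\<Sum>v\<in>sym_perms (Suc n). G (bub v))"
    by (rule sum_sym_perms_bub[OF n, symmetric])
  also have "\<dots> = (\<Sum>p\<in>sym_perms n. \<Sum>v\<in>{v \<in> sym_perms (Suc n). bub v = p}. G (bub v))"
    using bub_permutes
    by (intro sum.group[symmetric] finite_sym_perms) (auto simp: sym_perms_def)
  also have "\<dots> = (\<Sum>p\<in>sym_perms n. 2 * (2 ^ card (Del_S n (inv p)) * G p))"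
  proof (rule sum.cong)
    fix p assume p: "p \<in> sym_perms n"
    have "(\<Sum>v\<in>{v \<in> sym_perms (Suc n). bub v = p}. G (bub v)) =
        of_nat (card {v \<in> sym_perms (Suc n). bub v = p}) * G p"
      by simp
    then show "(\<Sum>v\<in>{v \<in> sym_perms (Suc n). bub v = p}. G (bub v)) =
        2 * (2 ^ card (Del_S n (inv p)) * G p)"
      unfolding card_bub_fibre[OF n p] by simp
  qed simp
  also have "\<dots> = 2 * (\<Sum>p\<in>sym_perms n. 2 ^ card (Del_S n (inv p)) * G p)"
    by (rule sum_distrib_left[symmetric])
  finally show ?thesis by simp
qed

text \<open>Here \<open>r\<close> stands for an \<open>A\<close>-statistic and \<open>t\<close> for
  its \<open>S\<close>-counterpart. The conditions concern \<open>inv v\<close>, and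
  \<open>inv_bub\<close> turns them into conditions on the inverse of \<open>bub v\<close>.\<close>

lemma sum_A_bub:
  assumes n: "1 \<le> n" and r: "\<And>v. v \<in> alt_perms (Suc n) \<Longrightarrow> r v = t (bub v)"
  shows "(\<Sum>v \<in> {v \<in> alt_perms (Suc n). Des_A n (inv v) \<subseteq> D1 \<and> Del_A n (inv v) \<subseteq> D2}.
      monom (1::int) (r v)) =
    (\<Sum>p\<in>sym_perms n. 2 ^ card (Del_S n (inv p)) *
      (if Des_S n (inv p) \<subseteq> D1 \<and> Suc ` Del_S n (inv p) \<subseteq> D2 then monom 1 (t p) else 0))"
proof -
  let ?P = "\<lambda>p. Des_S n (inv p) \<subseteq> D1 \<and> Suc ` Del_S n (inv p) \<subseteq> D2"
  have "finite (alt_perms (Suc n))"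
    by (rule finite_subset[OF _ finite_sym_perms]) (auto simp: alt_perms_def sym_perms_def)
  then have "(\<Sum>v \<in> {v \<in> alt_perms (Suc n). Des_A n (inv v) \<subseteq> D1 \<and> Del_A n (inv v) \<subseteq> D2}.
      monom (1::int) (r v)) =
    (\<Sum>v\<in>alt_perms (Suc n). if Des_A n (inv v) \<subseteq> D1 \<and> Del_A n (inv v) \<subseteq> D2
      then monom 1 (r v) else 0)"
    by (rule sum.inter_filter)
  also have "\<dots> = (\<Sum>v\<in>alt_perms (Suc n). if ?P (bub v) then monom 1 (t (bub v)) else 0)"
  proof (rule sum.cong)
    fix v assume v: "v \<in> alt_perms (Suc n)"
    then have vp: "v permutes {1..Suc n}" by (simp add: alt_perms_def)
    have inv: "inv v \<in> alt_perms (Suc n)" "inv v permutes {1..Suc n}"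
      using v vp by (auto intro: inv_in_alt_perms permutes_inv)
    show "(if Des_A n (inv v) \<subseteq> D1 \<and> Del_A n (inv v) \<subseteq> D2 then monom (1::int) (r v) else 0) =
        (if ?P (bub v) then monom 1 (t (bub v)) else 0)"
      by (simp only: Des_A_eq_Des_S_bub[OF n inv(1)] Del_A_bub[OF inv(2)] inv_bub[OF vp] r[OF v])
  qed simp
  also have "\<dots> = (\<Sum>p\<in>sym_perms n. 2 ^ card (Del_S n (inv p)) *
      (if ?P p then monom 1 (t p) else 0))"
    by (rule sum_alt_perms_bub[OF n, of "\<lambda>p. if ?P p then monom 1 (t p) else 0"])
  finally show ?thesis .
qed

theorem theorem9p1:
  fixes n :: nat and D1 D2 :: "nat set"
  assumes "n \<ge> 1" and "D1 \<subseteq> {1..n - 1}" and "D2 \<subseteq> {1..n - 1}"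
  shows "(\<Sum>p \<in> {p \<in> sym_perms n. Des_S n (inv p) \<subseteq> D1 \<and> Del_S n (inv p) \<subseteq> D2}.
            monom (1::int) (rmaj_S n p)) =
         (\<Sum>p \<in> {p \<in> sym_perms n. Des_S n (inv p) \<subseteq> D1 \<and> Del_S n (inv p) \<subseteq> D2}.
            monom (1::int) (ell_S n p)) \<and>
         (\<Sum>p \<in> {p \<in> alt_perms (n + 1). Des_A n (inv p) \<subseteq> D1 \<and> Del_A n (inv p) \<subseteq> D2}.
            monom (1::int) (rmaj_A n p)) =
         (\<Sum>p \<in> {p \<in> alt_perms (n + 1). Des_A n (inv p) \<subseteq> D1 \<and> Del_A n (inv p) \<subseteq> D2}.
            monom (1::int) (ell_A n p))"
proof
  show "(\<Sum>p \<in> {p \<in> sym_perms n. Des_S n (inv p) \<subseteq> D1 \<and> Del_S n (inv p) \<subseteq> D2}.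
            monom (1::int) (rmaj_S n p)) =
         (\<Sum>p \<in> {p \<in> sym_perms n. Des_S n (inv p) \<subseteq> D1 \<and> Del_S n (inv p) \<subseteq> D2}.
            monom (1::int) (ell_S n p))"
    unfolding sum.inter_filter[OF finite_sym_perms]
    by (rule S_equidistribution[of "\<lambda>D L k. if D \<subseteq> D1 \<and> L \<subseteq> D2 then monom 1 k else 0"])
next
  have rmaj: "rmaj_A n v = rmaj_S n (bub v)" if "v \<in> alt_perms (Suc n)" for v
    using Des_A_eq_Des_S_bub[OF \<open>n \<ge> 1\<close> that] by (simp add: rmaj_A_def rmaj_S_def)
  \<comment> \<open>The fibre size depends only on the \<open>Del_S\<close> set of the inverse, one
    of the arguments of \<open>F\<close> in \<open>S_equidistribution\<close>, so it can be absorbed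
    into the weight.\<close>
  let ?F = "\<lambda>D L k. 2 ^ card L *
      (if D \<subseteq> D1 \<and> Suc ` L \<subseteq> D2 then monom (1::int) k else 0)"
  have "(\<Sum>p \<in> {p \<in> alt_perms (Suc n). Des_A n (inv p) \<subseteq> D1 \<and> Del_A n (inv p) \<subseteq> D2}.
      monom (1::int) (rmaj_A n p)) =
    (\<Sum>p\<in>sym_perms n. ?F (Des_S n (inv p)) (Del_S n (inv p)) (rmaj_S n p))"
    by (rule sum_A_bub[OF \<open>n \<ge> 1\<close>]) (rule rmaj)
  also have "\<dots> = (\<Sum>p\<in>sym_perms n. ?F (Des_S n (inv p)) (Del_S n (inv p)) (ell_S n p))"
    by (rule S_equidistribution)
  also have "\<dots> =
    (\<Sum>p \<in> {p \<in> alt_perms (Suc n). Des_A n (inv p) \<subseteq> D1 \<and> Del_A n (inv p) \<subseteq> D2}.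
      monom (1::int) (ell_A n p))"
    by (rule sum_A_bub[OF \<open>n \<ge> 1\<close>, symmetric]) (rule ell_A_eq_ell_S_bub[OF \<open>n \<ge> 1\<close>])
  finally show "(\<Sum>p \<in> {p \<in> alt_perms (n + 1). Des_A n (inv p) \<subseteq> D1 \<and> Del_A n (inv p) \<subseteq> D2}.
            monom (1::int) (rmaj_A n p)) =
         (\<Sum>p \<in> {p \<in> alt_perms (n + 1). Des_A n (inv p) \<subseteq> D1 \<and> Del_A n (inv p) \<subseteq> D2}.
            monom (1::int) (ell_A n p))"
    by (simp only: Suc_eq_plus1)
qed

end
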